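(* Let $X\geq 3$, $C_1,C_2>0$. Suppose $\chi_0,\chi_1,\chi_2,\chi_3$ are Dirichlet characters modulo $8$ such that $\chi_i$ and $\chi_j$ are non-principal for some pair $(i,j)\in\{0,1\}\times\{2,3\}$. Then for any odd integers $1\leq r_0,r_1,r_2,r_3\leq(\log X)^{C_1}$ and any integers $1\leq c_{01},c_{23},M\leq(\log X)^{C_2}$ we have $$\mathop{\sum\sum\sum\sum}_{\substack{\|n_0n_1c_{01},n_2n_3c_{23}\|\cdot M\leq X\\ \gcd(n_i,2r_i)=1\ \forall\,0\leq i\leq 3}}\frac{\chi_0(n_0)\chi_2(n_2)\chi_1(n_1)\chi_3(n_3)}{\tau(n_0)\tau(n_1)\tau(n_2)\tau(n_3)}\ll_{C_1,C_2}\frac{\tau(r_0)\tau(r_1)\tau(r_2)\tau(r_3)X^2}{c_{01}c_{23}M^2(\log X)},$$ where the sum is over $(n_0,n_1,n_2,n_3)\in\mathbb{N}^4$ and the implied constant depends at most on $C_1$ and $C_2$.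
   Context: $\mathbb{N}$ is the set of positive integers, $\|a,b\|=\max\{|a|,|b|\}$, $\tau$ is the divisor-counting function. $A\ll B$ means $|A|\leq CB$ for a constant $C>0$ with the stated dependence. *)

theory Defs
  imports Complex_Main "HOL-Computational_Algebra.Primes"
begin

definition dirichlet_character :: "nat \<Rightarrow> (int \<Rightarrow> complex) \<Rightarrow> bool" where
  "dirichlet_character q \<chi> \<longleftrightarrow>
     (\<forall>a b. \<chi> (a * b) = \<chi> a * \<chi> b) \<and>
     (\<forall>a. \<chi> (a + int q) = \<chi> a) \<and>
     (\<forall>a. \<chi> a = 0 \<longleftrightarrow> \<not> coprime a (int q))"

definition principal_character :: "nat \<Rightarrow> int \<Rightarrow> complex" where
  "principal_character q a = (if coprime a (int q) then 1 else 0)"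

definition divisor_count :: "nat \<Rightarrow> nat" where
  "divisor_count n = card {d. d dvd n}"

definition max_norm :: "real \<Rightarrow> real \<Rightarrow> real" where
  "max_norm a b = max \<bar>a\<bar> \<bar>b\<bar>"

definition summation_range ::
    "real \<Rightarrow> (nat \<Rightarrow> nat) \<Rightarrow> nat \<Rightarrow> nat \<Rightarrow> nat \<Rightarrow> (nat \<times> nat \<times> nat \<times> nat) set" where
  "summation_range X r c01 c23 M =
     {(n0, n1, n2, n3).
        n0 \<ge> 1 \<and> n1 \<ge> 1 \<and> n2 \<ge> 1 \<and> n3 \<ge> 1 \<and>
        max_norm (real (n0 * n1 * c01)) (real (n2 * n3 * c23)) * real M \<le> X \<and>
        gcd n0 (2 * r 0) = 1 \<and> gcd n1 (2 * r 1) = 1 \<and>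
        gcd n2 (2 * r 2) = 1 \<and> gcd n3 (2 * r 3) = 1}"

text \<open>A sum over an infinite set is 0 by convention, so finiteness of the range matters.\<close>

lemma finite_summation_range:
  assumes "c01 \<ge> 1" "c23 \<ge> 1" "M \<ge> 1"
  shows "finite (summation_range X r c01 c23 M)"
proof -
  define N where "N = nat \<lfloor>X\<rfloor>"
  have le: "a \<le> N \<and> b \<le> N"
    if "a \<ge> 1" "b \<ge> 1" "c \<ge> 1" "real (a * b * c) * real M \<le> X" for a b c :: nat
  proof -
    have "real (a * b * c * M) \<le> X"
      using that(4) by simp
    then have N: "a * b * c * M \<le> N"
      unfolding N_def by (simp only: le_nat_floor)
    have "a dvd a * b * c * M" "b dvd a * b * c * M" "a * b * c * M > 0"
      using that(1-3) assms(3) by auto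
    then show ?thesis
      using N dvd_imp_le le_trans by blast
  qed
  have "n0 \<le> N \<and> n1 \<le> N \<and> n2 \<le> N \<and> n3 \<le> N"
    if mem: "(n0, n1, n2, n3) \<in> summation_range X r c01 c23 M" for n0 n1 n2 n3
  proof -
    have "real (n0 * n1 * c01) * real M
            \<le> max_norm (real (n0 * n1 * c01)) (real (n2 * n3 * c23)) * real M"
         "real (n2 * n3 * c23) * real M
            \<le> max_norm (real (n0 * n1 * c01)) (real (n2 * n3 * c23)) * real M"
      unfolding max_norm_def by (intro mult_right_mono; simp)+
    then have "real (n0 * n1 * c01) * real M \<le> X" "real (n2 * n3 * c23) * real M \<le> X"
      using mem unfolding summation_range_def by auto
    then show ?thesis
      using mem le[of n0 n1 c01] le[of n2 n3 c23] assms
      unfolding summation_range_def by simp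
  qed
  then have "summation_range X r c01 c23 M \<subseteq> {..N} \<times> {..N} \<times> {..N} \<times> {..N}"
    by auto
  then show ?thesis
    by (rule finite_subset) simp
qed

end

theory Submission
  imports Defs "HOL-Computational_Algebra.Squarefree"
begin

text \<open>
  The condition on the maximum norm is a conjunction, so the fourfold sum is a product of two sums
  over pairs, each containing a nonprincipal character. It therefore suffices to save a factor
  \<open>sqrt (ln X)\<close> in each of them (\<open>pair_sum_bound\<close>). All characters modulo 8 are real. Grouping the pairs
  by their product \<open>n\<close>, the sum over pairs with characters \<open>\<psi>\<close> and \<open>\<phi>\<close> becomes the summatory
  function of a multiplicative function \<open>f\<close> with \<open>\<bar>f n\<bar> \<le> 1\<close> and \<open>f p = (\<psi> p + \<phi> p) / 2\<close> for primes
  \<open>p\<close> outside the moduli. There are two cases, and both are elementary.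

  If \<open>\<psi> \<noteq> \<phi>\<close>, then \<open>f\<close> vanishes at half of the primes, and it is enough to bound the size of its
  support (\<open>twisted_pair_sum_distinct\<close>). An argument of Halberstam and Richert (\<open>card_mult_ln_le\<close>),
  resting on Chebyshev's bound, reduces counting to logarithmic sums. Up to a squarefull factor and
  a divisor of the moduli, the support consists of integers all of whose primes satisfy
  \<open>\<psi> p * \<phi> p = 1\<close>. The logarithmic sum over these integers is at most of order \<open>sqrt (ln N)\<close> because
  its square is dominated by the logarithmic sum of \<open>\<Sum>d | d dvd n. \<psi> d * \<phi> d\<close>, which is at most of order \<open>ln N\<close> since the
  partial sums of \<open>\<psi> d * \<phi> d / d\<close> are bounded (\<open>sum_all_primes_char_le\<close>).

  If \<open>\<psi> = \<phi>\<close>, then \<open>f\<close> has absolute value 1 at almost all primes and the saving must come from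
  cancellation (\<open>twisted_pair_sum_equal\<close>). Here \<open>f = \<psi> g\<close> with \<open>g\<close> close to the constant 1, in the sense
  that \<open>g\<close> is a divisor sum of a bounded function supported on squarefull numbers times divisors of
  the moduli; so boundedness of the partial sums of \<open>\<psi>\<close> gives a saving of a power of \<open>N\<close>.

  In both cases the coprimality conditions cost only the number of divisors of the moduli, and
  \<open>ln (X / (c * M))\<close> is comparable to \<open>ln X\<close> (\<open>ln_le_ln_quotient\<close>).
\<close>

section \<open>Divisor sums and multiplicative functions\<close>

lemma divisor_count_pos: "n > 0 \<Longrightarrow> divisor_count n > 0"
  unfolding divisor_count_def by (auto simp: card_gt_0_iff finite_divisors_nat)

lemma divisor_count_mult_le:
  assumes "a > 0" "b > 0"
  shows "divisor_count (a * b) \<le> divisor_count a * divisor_count b"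
proof -
  have "{d. d dvd a * b} \<subseteq> (\<lambda>(x, y). x * y) ` ({d. d dvd a} \<times> {d. d dvd b})"
  proof
    fix d assume "d \<in> {d. d dvd a * b}"
    then obtain x y where "d = x * y \<and> x dvd a \<and> y dvd b"
      using division_decomp by blast
    then show "d \<in> (\<lambda>(x, y). x * y) ` ({d. d dvd a} \<times> {d. d dvd b})"
      by auto
  qed
  then have "card {d. d dvd a * b} \<le> card ({d. d dvd a} \<times> {d. d dvd b})"
    using assms by (intro surj_card_le) (auto simp: finite_divisors_nat)
  then show ?thesis
    by (simp add: divisor_count_def card_cartesian_product)
qed

text \<open>When \<open>a\<close> and \<open>b\<close> are coprime, \<open>(x, y) \<mapsto> x * y\<close> is a bijection between pairs of divisors and
  divisors of the product. The multiplicativity of the divisor function and of Dirichlet convolutions rests on this.\<close>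
lemma sum_divisors_coprime_mult:
  fixes a b :: nat and f :: "nat \<Rightarrow> 'a::comm_monoid_add"
  assumes "coprime a b" "a > 0" "b > 0"
  shows "(\<Sum>d | d dvd a * b. f d) = (\<Sum>x | x dvd a. \<Sum>y | y dvd b. f (x * y))"
proof -
  have inj: "inj_on (\<lambda>(x, y). x * y) ({d. d dvd a} \<times> {d. d dvd b})"
  proof (rule inj_onI, clarify)
    fix x y x' y' assume h: "x dvd a" "y dvd b" "x' dvd a" "y' dvd b" "x * y = x' * y'"
    have cop: "coprime u v" if "u dvd a" "v dvd b" for u v
      using that assms(1) coprime_divisors by blast
    have "x dvd x' * y'" "x' dvd x * y"
      using h(5) by (metis dvd_triv_left)+
    then have "x dvd x'" "x' dvd x"
      using cop[OF h(1) h(4)] cop[OF h(3) h(2)] by (simp_all add: coprime_dvd_mult_left_iff)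
    then have "x = x'" by (rule dvd_antisym)
    moreover have "y dvd x' * y'" "y' dvd x * y"
      using h(5) by (metis dvd_triv_right)+
    then have "y dvd y'" "y' dvd y"
      using cop[OF h(3) h(2)] cop[OF h(1) h(4)]
      by (simp_all add: coprime_dvd_mult_right_iff coprime_commute)
    then have "y = y'" by (rule dvd_antisym)
    ultimately show "x = x' \<and> y = y'" by simp
  qed
  have img: "(\<lambda>(x, y). x * y) ` ({d. d dvd a} \<times> {d. d dvd b}) = {d. d dvd a * b}"
    (is "?L = ?R")
  proof
    show "?L \<subseteq> ?R" by (auto intro: mult_dvd_mono)
    show "?R \<subseteq> ?L"
    proof
      fix d assume "d \<in> ?R"
      then obtain x y where "d = x * y \<and> x dvd a \<and> y dvd b"
        using division_decomp by blast
      then show "d \<in> ?L" by auto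
    qed
  qed
  have "(\<Sum>d | d dvd a * b. f d)
      = (\<Sum>z\<in>{d. d dvd a} \<times> {d. d dvd b}. f (case z of (x, y) \<Rightarrow> x * y))"
    by (subst img[symmetric], subst sum.reindex[OF inj]) (simp add: o_def)
  also have "\<dots> = (\<Sum>x | x dvd a. \<Sum>y | y dvd b. f (x * y))"
    by (subst sum.cartesian_product) (simp add: case_prod_unfold)
  finally show ?thesis .
qed

definition multiplicative :: "(nat \<Rightarrow> real) \<Rightarrow> bool" where
  "multiplicative f \<longleftrightarrow>
     f 1 = 1 \<and> (\<forall>a>0. \<forall>b>0. coprime a b \<longrightarrow> f (a * b) = f a * f b)"

lemma multiplicativeD:
  "multiplicative f \<Longrightarrow> a > 0 \<Longrightarrow> b > 0 \<Longrightarrow> coprime a b \<Longrightarrow> f (a * b) = f a * f b"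
  "multiplicative f \<Longrightarrow> f (Suc 0) = 1"
  by (auto simp: multiplicative_def)

lemma multiplicative_mult:
  "multiplicative f \<Longrightarrow> multiplicative g \<Longrightarrow> multiplicative (\<lambda>n. f n * g n)"
  by (simp add: multiplicative_def)

definition dconv :: "(nat \<Rightarrow> real) \<Rightarrow> (nat \<Rightarrow> real) \<Rightarrow> nat \<Rightarrow> real" where
  "dconv u v n = (\<Sum>d | d dvd n. u d * v (n div d))"

lemma multiplicative_dconv:
  assumes u: "multiplicative u" and v: "multiplicative v"
  shows "multiplicative (dconv u v)"
  unfolding multiplicative_def
proof (intro conjI allI impI)
  show "dconv u v 1 = 1"
    using u v by (simp add: dconv_def multiplicative_def)
next
  fix a b :: nat assume ab: "a > 0" "b > 0" "coprime a b"
  have "u (x * y) * v (a * b div (x * y)) = (u x * v (a div x)) * (u y * v (b div y))"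
    if xy: "x dvd a" "y dvd b" for x y
  proof -
    have "a * b div (x * y) = (a div x) * (b div y)"
      using xy by (simp add: div_mult_div_if_dvd)
    moreover have "coprime x y"
      using xy ab(3) by (rule coprime_divisors)
    moreover have "a div x dvd a" "b div y dvd b"
      using xy by (metis dvd_mult_div_cancel dvd_triv_right)+
    then have "coprime (a div x) (b div y)"
      using ab(3) by (rule coprime_divisors)
    moreover have "x > 0" "y > 0"
      using xy ab by (auto intro!: Nat.gr0I)
    moreover have "a div x > 0" "b div y > 0"
      using xy ab by (metis dvd_div_eq_0_iff neq0_conv)+
    ultimately show ?thesis
      using u v by (simp add: multiplicativeD)
  qed
  then show "dconv u v (a * b) = dconv u v a * dconv u v b"
    using ab by (simp add: dconv_def sum_divisors_coprime_mult sum_product)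
qed

text \<open>Every \<open>n > 1\<close> splits off the full power of one of its primes, leaving a cofactor that is coprime
  to it. This is the form of induction that suits multiplicative functions.\<close>
lemma coprime_prime_power_induct [consumes 1, case_names one mult]:
  fixes n :: nat
  assumes "n > 0"
    and one: "P 1"
    and step: "\<And>p k m. prime p \<Longrightarrow> k > 0 \<Longrightarrow> m > 0 \<Longrightarrow> coprime p m \<Longrightarrow> P m \<Longrightarrow> P (p ^ k * m)"
  shows "P n"
  using \<open>n > 0\<close>
proof (induction n rule: less_induct)
  case (less n)
  show ?case
  proof (cases "n = 1")
    case True then show ?thesis using one by simp
  next
    case False
    then obtain p where p: "prime p" "p dvd n"
      using prime_factor_nat by blast
    then obtain m where m: "n = p ^ multiplicity p n * m" "\<not> p dvd m"
      using less.prems p(1) by (metis multiplicity_decompose' not_prime_unit neq0_conv)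
    have k: "multiplicity p n > 0"
      using p less.prems by (simp add: prime_multiplicity_gt_zero_iff)
    have m0: "m > 0" using m(1) less.prems by (cases "m = 0") auto
    have "1 < p ^ multiplicity p n"
      using one_less_power[OF prime_gt_1_nat[OF p(1)] k] .
    then have "m < n" using m(1) m0 by (metis mult_less_cancel2 mult_1)
    moreover have "coprime p m" using p(1) m(2) by (simp add: prime_imp_coprime)
    ultimately show ?thesis
      using step[OF p(1) k m0] less.IH m0 m(1) by simp
  qed
qed

lemma multiplicative_eqI:
  assumes "multiplicative f" "multiplicative g" "n > 0"
    and "\<And>p k. prime p \<Longrightarrow> k > 0 \<Longrightarrow> f (p ^ k) = g (p ^ k)"
  shows "f n = g n"
  using \<open>n > 0\<close>
proof (induction n rule: coprime_prime_power_induct)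
  case one
  then show ?case using assms(1,2) by (simp add: multiplicative_def)
next
  case (mult p k m)
  moreover have "p ^ k > 0" using mult(1) prime_gt_0_nat by simp
  moreover have "coprime (p ^ k) m" using mult by simp
  ultimately show ?case using assms by (simp add: multiplicativeD)
qed

lemma divisors_prime_power_nat:
  fixes p :: nat
  assumes "prime p"
  shows "{d. d dvd p ^ k} = (\<lambda>i. p ^ i) ` {..k}"
  using divides_primepow_nat[OF assms] by auto

lemma sum_divisors_prime_power:
  fixes p :: nat and f :: "nat \<Rightarrow> 'a::comm_monoid_add"
  assumes "prime p"
  shows "(\<Sum>d | d dvd p ^ k. f d) = (\<Sum>i\<le>k. f (p ^ i))"
proof -
  have "inj_on (\<lambda>i. p ^ i) {..k}"
    using prime_gt_1_nat[OF assms] by (auto simp: inj_on_def power_inject_exp)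
  then show ?thesis
    by (simp add: divisors_prime_power_nat[OF assms] sum.reindex)
qed

text \<open>Both sides run over the lattice points \<open>d * m \<le> N\<close>, once along hyperbolas and once along
  vertical lines.\<close>
lemma sum_divisors_swap:
  fixes f :: "nat \<Rightarrow> nat \<Rightarrow> real"
  shows "(\<Sum>n=1..N. \<Sum>d | d dvd n. f d (n div d)) = (\<Sum>d=1..N. \<Sum>m=1..N div d. f d m)"
proof -
  have "(\<Sum>n=1..N. \<Sum>d | d dvd n. f d (n div d))
      = (\<Sum>(n, d)\<in>(SIGMA n:{1..N}. {d. d dvd n}). f d (n div d))"
    by (intro sum.Sigma) (auto intro: finite_divisors_nat)
  also have "\<dots> = (\<Sum>(d, m)\<in>(SIGMA d:{1..N}. {1..N div d}). f d m)"
    apply (rule sum.reindex_bij_witness[of _ "\<lambda>(d, m). (d * m, d)" "\<lambda>(n, d). (d, n div d)"])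
    subgoal by auto
    subgoal for x
    proof -
      assume "x \<in> (SIGMA n:{1..N}. {d. d dvd n})"
      then obtain n d where x: "x = (n, d)" "1 \<le> n" "n \<le> N" "d dvd n" by auto
      have "1 \<le> d" "d \<le> n" using x by (auto intro: Nat.gr0I dvd_imp_le simp: Suc_le_eq)
      moreover have "n div d > 0" using x \<open>d \<le> n\<close> \<open>1 \<le> d\<close> by (simp add: div_greater_zero_iff)
      moreover have "n div d \<le> N div d" using x by (simp add: div_le_mono)
      ultimately show ?thesis using x by auto
    qed
    subgoal by auto
    subgoal for x
    proof -
      assume "x \<in> (SIGMA d:{1..N}. {1..N div d})"
      then obtain d m where x: "x = (d, m)" "1 \<le> d" "d \<le> N" "1 \<le> m" "m \<le> N div d" by auto
      have "d * m \<le> d * (N div d)" using x by simp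
      also have "\<dots> \<le> N" by simp
      finally show ?thesis using x by auto
    qed
    subgoal by auto
    done
  also have "\<dots> = (\<Sum>d=1..N. \<Sum>m=1..N div d. f d m)"
    by (intro sum.Sigma[symmetric]) auto
  finally show ?thesis .
qed

section \<open>Squarefull numbers\<close>

definition squarefull :: "nat \<Rightarrow> bool" where
  "squarefull b \<longleftrightarrow> b > 0 \<and> (\<forall>p. prime p \<longrightarrow> p dvd b \<longrightarrow> p ^ 2 dvd b)"

text \<open>Write \<open>b = s * t\<^sup>2\<close> with \<open>s\<close> squarefree. A prime dividing \<open>s\<close> occurs in \<open>b\<close> to an odd power
  which is at least 2, hence at least 3, so it also divides \<open>t\<close>. Thus \<open>s\<close> divides \<open>t\<close>, and a factor
  \<open>s\<^sup>2\<close> can be moved from \<open>t\<^sup>2\<close> to \<open>s\<close>.\<close>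
lemma squarefull_decompose:
  assumes "squarefull b"
  obtains u v :: nat where "b = u ^ 2 * v ^ 3" "u > 0" "v > 0"
proof -
  define s t where "s = squarefree_part b" and "t = square_part b"
  have b: "b = s * t ^ 2" "b > 0"
    using assms squarefree_decompose[of b] by (auto simp: s_def t_def squarefull_def)
  then have pos: "s > 0" "t > 0" by (auto intro!: Nat.gr0I)
  have sqf: "squarefree s" by (simp add: s_def)
  have pt: "p dvd t" if p: "prime p" "p dvd s" for p
  proof (rule ccontr)
    assume "\<not> p dvd t"
    then have "coprime (p ^ 2) (t ^ 2)"
      using p(1) by (simp add: prime_imp_coprime)
    moreover have "p ^ 2 dvd s * t ^ 2"
      using assms p b unfolding squarefull_def by (metis dvd_mult2)
    ultimately have "p ^ 2 dvd s"
      by (simp add: coprime_dvd_mult_left_iff)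
    then have "p dvd 1" using sqf squarefreeD by blast
    then show False using p(1) by simp
  qed
  have "multiplicity p s \<le> multiplicity p t" if p: "prime p" for p
  proof (cases "p dvd s")
    case True
    then have "multiplicity p t > 0"
      using p pt pos by (simp add: prime_multiplicity_gt_zero_iff)
    moreover have "multiplicity p s \<le> 1"
      using sqf pos p squarefree_factorial_semiring''[of s] by simp
    ultimately show ?thesis by linarith
  qed (simp add: not_dvd_imp_multiplicity_0)
  then have "s dvd t"
    using pos by (intro multiplicity_le_imp_dvd) auto
  then obtain k where "t = s * k" by blast
  then have "b = k ^ 2 * s ^ 3" "k > 0"
    using b pos by (auto simp: power2_eq_square power3_eq_cube)
  then show ?thesis using that pos by blast
qed

text \<open>The terms are dominated by the telescoping differences \<open>2 / sqrt (n - 1) - 2 / sqrt n\<close>.\<close>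
lemma sum_powr_three_halves_le:
  assumes "finite A"
  shows "(\<Sum>n\<in>A. real n powr (-3/2)) \<le> 3"
proof -
  have initial: "(\<Sum>n=1..N. real n powr (-3/2)) \<le> 3 - 2 / sqrt (real N)" if "N \<ge> 1" for N
    using that
  proof (induction N rule: dec_induct)
    case (step N)
    define a b where "a = sqrt (real N)" and "b = sqrt (real (Suc N))"
    have ab: "a > 0" "b > 0" "a \<le> b" "b\<^sup>2 - a\<^sup>2 = 1" using step by (simp_all add: a_def b_def)
    have "real (Suc N) powr (-3/2) = 1 / b ^ 3"
    proof -
      have "b ^ 3 = b powr 3" using ab(2) by simp
      also have "\<dots> = real (Suc N) powr (3/2)"
        by (simp add: b_def powr_half_sqrt[symmetric] powr_powr)
      finally show ?thesis by (simp add: powr_minus_divide)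
    qed
    also have "\<dots> \<le> 2 / (a * b * (a + b))"
    proof -
      have "a * b * (a + b) \<le> b * b * (b + b)"
        using ab by (intro mult_mono add_mono) auto
      then have "2 / (b * b * (b + b)) \<le> 2 / (a * b * (a + b))"
        using ab by (intro divide_left_mono) auto
      moreover have "2 / (b * b * (b + b)) = 1 / b ^ 3"
        using ab(2) by (simp add: power3_eq_cube field_simps)
      ultimately show ?thesis by simp
    qed
    also have "\<dots> = 2 / a - 2 / b"
    proof -
      have "(b - a) * (a + b) = 1" using ab(4) by (simp add: power2_eq_square algebra_simps)
      then have "2 / (a * b * (a + b)) = 2 * ((b - a) * (a + b)) / (a * b * (a + b))" by simp
      also have "\<dots> = (2 * (b - a)) * (a + b) / (a * b * (a + b))" by simp
      also have "\<dots> = 2 * (b - a) / (a * b)"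
        using ab by (intro nonzero_mult_divide_mult_cancel_right) simp
      also have "\<dots> = 2 / a - 2 / b" using ab by (simp add: field_simps)
      finally show ?thesis .
    qed
    finally have "real (Suc N) powr (-3/2) \<le> 2 / a - 2 / b" .
    moreover have "(\<Sum>n=1..Suc N. real n powr (-3/2))
        = (\<Sum>n=1..N. real n powr (-3/2)) + real (Suc N) powr (-3/2)" by simp
    ultimately show ?case using step.IH unfolding a_def b_def by linarith
  qed simp
  define N where "N = Suc (Max (insert 0 A))"
  have "n \<le> N" if "n \<in> A" for n
    using that assms by (simp add: N_def le_SucI)
  then have "(\<Sum>n\<in>A. real n powr (-3/2)) \<le> (\<Sum>n=0..N. real n powr (-3/2))"
    using assms by (intro sum_mono2) auto
  also have "\<dots> = (\<Sum>n=1..N. real n powr (-3/2))"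
    by (simp add: sum.atLeast_Suc_atMost)
  also have "\<dots> \<le> 3"
    using initial[of N] by (rule order_trans) (simp_all add: N_def)
  finally show ?thesis .
qed

text \<open>Squarefull numbers are sparse: their Dirichlet series converges for every exponent above \<open>1/2\<close>.
  The exponent \<open>3/4\<close> is a compromise that serves two purposes at once. It bounds the sum of the
  reciprocals of squarefull numbers, and it shows that only \<open>O(N powr (3/4))\<close> of them lie below \<open>N\<close>,
  which saves more than any power of \<open>ln N\<close>.\<close>
lemma bounded_sum_squarefull:
  "\<exists>D>0. \<forall>B. finite B \<longrightarrow> (\<forall>b\<in>B. squarefull b) \<longrightarrow> (\<Sum>b\<in>B. real b powr (-3/4)) \<le> D"
proof -
  have "(\<Sum>b\<in>B. real b powr (-3/4)) \<le> 3 * 3" if B: "finite B" "\<And>b. b \<in> B \<Longrightarrow> squarefull b" for B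
  proof -
    have "\<forall>b\<in>B. \<exists>w::nat\<times>nat. b = fst w ^ 2 * snd w ^ 3 \<and> fst w > 0 \<and> snd w > 0"
      using B(2) squarefull_decompose by (metis fst_conv snd_conv)
    then obtain g :: "nat \<Rightarrow> nat \<times> nat"
      where g: "\<And>b. b \<in> B \<Longrightarrow> b = fst (g b) ^ 2 * snd (g b) ^ 3 \<and> fst (g b) > 0 \<and> snd (g b) > 0"
      by metis
    have inj: "inj_on g B" by (rule inj_onI) (metis g)
    have "(\<Sum>b\<in>B. real b powr (-3/4))
        \<le> (\<Sum>b\<in>B. real (fst (g b)) powr (-3/2) * real (snd (g b)) powr (-3/2))"
    proof (rule sum_mono)
      fix b assume "b \<in> B"
      define u v where "u = real (fst (g b))" and "v = real (snd (g b))"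
      have uv: "real b = u ^ 2 * v ^ 3" "u \<ge> 1" "v \<ge> 1"
        using g[OF \<open>b \<in> B\<close>] unfolding u_def v_def by (metis of_nat_mult of_nat_power, linarith+)
      have "real b = u powr 2 * v powr 3" using uv by simp
      then have "real b powr (-3/4) = (u powr 2) powr (-3/4) * (v powr 3) powr (-3/4)"
        using uv(2,3) by (simp only: powr_mult)
      also have "\<dots> = u powr (-3/2) * v powr (-9/4)"
        by (simp only: powr_powr) simp
      also have "\<dots> \<le> u powr (-3/2) * v powr (-3/2)"
        using uv by (intro mult_left_mono powr_mono) auto
      finally show "real b powr (-3/4)
          \<le> real (fst (g b)) powr (-3/2) * real (snd (g b)) powr (-3/2)"
        by (simp add: u_def v_def)
    qed
    also have "\<dots> = (\<Sum>w\<in>g ` B. real (fst w) powr (-3/2) * real (snd w) powr (-3/2))"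
      by (simp add: sum.reindex[OF inj])
    also have "\<dots> \<le> (\<Sum>w\<in>(fst ` g ` B) \<times> (snd ` g ` B). real (fst w) powr (-3/2) * real (snd w) powr (-3/2))"
    proof (rule sum_mono2)
      show "g ` B \<subseteq> (fst ` g ` B) \<times> (snd ` g ` B)"
        by (metis subset_fst_snd)
    qed (use B(1) in auto)
    also have "\<dots> = (\<Sum>u\<in>fst ` g ` B. real u powr (-3/2)) * (\<Sum>v\<in>snd ` g ` B. real v powr (-3/2))"
      by (simp add: sum_product sum.cartesian_product case_prod_unfold)
    also have "\<dots> \<le> 3 * 3"
      using B(1) by (intro mult_mono sum_powr_three_halves_le sum_nonneg) auto
    finally show ?thesis .
  qed
  then show ?thesis by (intro exI[of _ "3 * 3"]) auto
qed

lemma card_squarefull_le: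
  assumes D: "\<forall>B. finite B \<longrightarrow> (\<forall>b\<in>B. squarefull b) \<longrightarrow> (\<Sum>b\<in>B. real b powr (-3/4)) \<le> D"
    and "N \<ge> 1"
  shows "real (card {b. squarefull b \<and> b \<le> N}) \<le> D * real N powr (3/4)"
proof -
  let ?B = "{b. squarefull b \<and> b \<le> N}"
  have "real (card ?B) * real N powr (-3/4) = (\<Sum>b\<in>?B. real N powr (-3/4))"
    by simp
  also have "\<dots> \<le> (\<Sum>b\<in>?B. real b powr (-3/4))"
    by (intro sum_mono powr_mono2') (auto simp: squarefull_def)
  also have "\<dots> \<le> D" by (rule D[rule_format]) auto
  finally show ?thesis
    using assms(2) by (simp add: powr_minus field_simps)
qed

section \<open>Chebyshev's upper bound\<close>

lemma prod_primes_dvd: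
  fixes n :: nat
  assumes "finite Q" "\<And>p. p \<in> Q \<Longrightarrow> prime p \<and> p dvd n"
  shows "\<Prod>Q dvd n"
  using assms
proof (induction Q rule: finite_induct)
  case (insert p Q)
  have "coprime p (\<Prod>Q)"
    using insert by (intro prod_coprime_right) (metis insertCI primes_coprime)
  then show ?case using insert by (simp add: divides_mult)
qed simp

text \<open>The primes in \<open>(m + 1, 2 * m + 1]\<close> all divide the binomial coefficient \<open>(2 * m + 1) choose m\<close>.
  This coefficient appears twice in row \<open>2 * m + 1\<close>, whose sum is \<open>2 * 4 ^ m\<close>, so it is at most
  \<open>4 ^ m\<close>.\<close>
lemma prod_primes_le_4_power: "\<Prod>{p. prime p \<and> p \<le> n} \<le> (4::nat) ^ n"
proof (induction n rule: less_induct)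
  case (less n)
  consider "n \<le> 1" | "n = 2" | "n > 2" "even n" | m where "m \<ge> 1" "n = 2 * m + 1"
  proof -
    have "n \<le> 1 \<or> n = 2 \<or> n > 2 \<and> even n \<or> (\<exists>m\<ge>1. n = 2 * m + 1)"
      by presburger
    then show ?thesis using that by blast
  qed
  then show ?case
  proof cases
    case 1
    then have none: "\<not> (prime p \<and> p \<le> n)" for p
      using prime_gt_1_nat[of p] by linarith
    show ?thesis by (simp only: none) simp
  next
    case 2
    then have "prime p \<and> p \<le> n \<longleftrightarrow> p = 2" for p
      using prime_ge_2_nat[of p] two_is_prime_nat by (metis le_antisym order_refl)
    then show ?thesis using 2 by simp
  next
    case 3
    then have "\<not> prime n" using prime_odd_nat by blast
    then have "prime p \<and> p \<le> n \<longleftrightarrow> prime p \<and> p \<le> n - 1" for p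
      by (cases "p = n") auto
    then have "\<Prod>{p. prime p \<and> p \<le> n} \<le> (4::nat) ^ (n - 1)"
      using less.IH[of "n - 1"] 3 by simp
    also have "\<dots> \<le> 4 ^ n" by (rule power_increasing) auto
    finally show ?thesis .
  next
    case (4 m)
    let ?C = "(2 * m + 1) choose m"
    let ?Q = "{p. prime p \<and> m + 1 < p \<and> p \<le> 2 * m + 1}"
    have "p dvd ?C" if "p \<in> ?Q" for p
    proof -
      have "fact m * fact (2 * m + 1 - m) * ?C = (fact (2 * m + 1) :: nat)"
        by (rule binomial_fact_lemma) simp
      moreover have p: "prime p" "\<not> p \<le> m" "\<not> p \<le> 2 * m + 1 - m" "p \<le> 2 * m + 1"
        using that by auto
      then have "p dvd (fact (2 * m + 1) :: nat)" "\<not> p dvd (fact m :: nat)"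
           "\<not> p dvd (fact (2 * m + 1 - m) :: nat)"
        by (simp_all only: prime_dvd_fact_iff not_False_eq_True)
      ultimately show ?thesis
        using p(1) prime_dvd_mult_iff by metis
    qed
    then have "\<Prod>?Q dvd ?C"
      by (intro prod_primes_dvd) auto
    moreover have "?C > 0" by (rule zero_less_binomial) simp
    ultimately have "\<Prod>?Q \<le> ?C" by (rule dvd_imp_le)
    also have "?C \<le> 4 ^ m"
    proof -
      have "2 * ?C = ?C + ((2 * m + 1) choose (m + 1))"
      proof -
        have "?C = (2 * m + 1) choose (2 * m + 1 - m)"
          by (rule binomial_symmetric) simp
        also have "2 * m + 1 - m = m + 1" by simp
        finally show ?thesis by linarith
      qed
      also have "\<dots> = (\<Sum>k\<in>{m, m + 1}. (2 * m + 1) choose k)"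
        by (subst sum.insert) (simp_all only: finite.intros sum.insert sum.empty, auto)
      also have "\<dots> \<le> (\<Sum>k\<le>2 * m + 1. (2 * m + 1) choose k)"
        by (rule sum_mono2) auto
      also have "\<dots> = 2 * 4 ^ m"
        by (simp only: choose_row_sum) (simp add: power_mult)
      finally show ?thesis by linarith
    qed
    finally have Q: "\<Prod>?Q \<le> 4 ^ m" .
    have "{p. prime p \<and> p \<le> n} = {p. prime p \<and> p \<le> m + 1} \<union> ?Q"
      using 4 by auto
    then have "\<Prod>{p. prime p \<and> p \<le> n} = \<Prod>{p. prime p \<and> p \<le> m + 1} * \<Prod>?Q"
      by (simp add: prod.union_disjoint disjoint_iff)
    also have "\<dots> \<le> 4 ^ (m + 1) * 4 ^ m"
      using less.IH[of "m + 1"] 4 Q by (intro mult_mono) auto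
    also have "\<dots> = 4 ^ n" by (simp add: 4 power_add mult_2)
    finally show ?thesis .
  qed
qed

lemma sum_ln_primes_le: "(\<Sum>p | prime p \<and> p \<le> n. ln (real p)) \<le> real n * ln 4"
proof -
  have "(\<Sum>p | prime p \<and> p \<le> n. ln (real p)) = ln (\<Prod>p | prime p \<and> p \<le> n. real p)"
    by (rule ln_prod[symmetric]) (auto simp: prime_gt_0_nat)
  also have "\<dots> = ln (real (\<Prod>{p. prime p \<and> p \<le> n}))" by simp
  also have "\<dots> \<le> ln (real (4 ^ n))"
    using prod_primes_le_4_power[of n]
    by (subst ln_le_cancel_iff) (auto intro!: prod_pos simp: prime_gt_0_nat simp del: of_nat_prod of_nat_power)
  also have "\<dots> = real n * ln 4" by (simp add: ln_realpow)
  finally show ?thesis .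
qed

definition prime_power :: "nat \<Rightarrow> bool" where
  "prime_power q \<longleftrightarrow> (\<exists>p k. prime p \<and> k > 0 \<and> q = p ^ k)"

lemma prime_power_prime_or_squarefull:
  assumes "prime_power q"
  shows "prime q \<or> squarefull q"
proof -
  obtain p k where q: "prime p" "k > 0" "q = p ^ k"
    using assms by (auto simp: prime_power_def)
  show ?thesis
  proof (cases "k = 1")
    case False
    then have "k \<ge> 2" using q by simp
    then have "r ^ 2 dvd q" if "prime r" "r dvd q" for r
      using that q by (metis le_imp_power_dvd prime_dvd_power primes_dvd_imp_eq)
    then show ?thesis using q by (simp add: squarefull_def prime_gt_0_nat)
  qed (use q in simp)
qed

text \<open>Weighting a prime power by its own logarithm, and not by that of its prime as in the von Mangoldt
  function, costs nothing in order of magnitude: the proper powers are squarefull, and these are too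
  sparse to matter.\<close>
lemma sum_ln_prime_powers_le:
  "\<exists>A>0. \<forall>n. (\<Sum>q | prime_power q \<and> q \<le> n. ln (real q)) \<le> A * real n"
proof -
  obtain D where D: "D > 0"
      "\<forall>B. finite B \<longrightarrow> (\<forall>b\<in>B. squarefull b) \<longrightarrow> (\<Sum>b\<in>B. real b powr (-3/4)) \<le> D"
    using bounded_sum_squarefull by blast
  have "(\<Sum>q | prime_power q \<and> q \<le> n. ln (real q)) \<le> (ln 4 + 4 * D) * real n" for n
  proof (cases "n = 0")
    case True
    then have "{q. prime_power q \<and> q \<le> n} = {}"
      by (auto simp: prime_power_def)
    then show ?thesis using True by simp
  next
    case False
    then have n: "n \<ge> 1" by simp
    let ?P = "{p. prime p \<and> p \<le> n}" and ?B = "{b. squarefull b \<and> b \<le> n}"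
    have nonneg: "ln (real q) \<ge> 0" if "q \<in> ?P \<union> ?B" for q
      using that by (auto simp: squarefull_def prime_gt_0_nat Suc_le_eq)
    have "(\<Sum>q | prime_power q \<and> q \<le> n. ln (real q)) \<le> (\<Sum>q\<in>?P \<union> ?B. ln (real q))"
      using prime_power_prime_or_squarefull nonneg by (intro sum_mono2) auto
    also have "\<dots> \<le> (\<Sum>q\<in>?P. ln (real q)) + (\<Sum>q\<in>?B. ln (real q))"
    proof -
      have "(\<Sum>q\<in>?P \<inter> ?B. ln (real q)) \<ge> 0"
        using nonneg by (intro sum_nonneg) blast
      moreover have "(\<Sum>q\<in>?P \<union> ?B. ln (real q)) + (\<Sum>q\<in>?P \<inter> ?B. ln (real q))
          = (\<Sum>q\<in>?P. ln (real q)) + (\<Sum>q\<in>?B. ln (real q))"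
        by (rule sum.union_inter) auto
      ultimately show ?thesis by linarith
    qed
    also have "(\<Sum>q\<in>?B. ln (real q)) \<le> (\<Sum>q\<in>?B. ln (real n))"
      by (intro sum_mono) (auto simp: squarefull_def)
    also have "\<dots> = real (card ?B) * ln (real n)" by simp
    also have "\<dots> \<le> (D * real n powr (3/4)) * (4 * real n powr (1/4))"
    proof (intro mult_mono card_squarefull_le D n)
      have "ln (real n) = 4 * ln (real n powr (1/4))" using n by (simp add: ln_powr)
      also have "\<dots> \<le> 4 * real n powr (1/4)"
        using n ln_le_minus_one[of "real n powr (1/4)"] by simp
      finally show "ln (real n) \<le> 4 * real n powr (1/4)" .
    qed (use n D in auto)
    also have "\<dots> = 4 * D * real n"
      using n by (simp add: powr_add[symmetric])
    finally show ?thesis using sum_ln_primes_le[of n] by (simp add: algebra_simps)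
  qed
  moreover have "ln 4 + 4 * D > 0" using D(1) by (intro add_pos_pos) auto
  ultimately show ?thesis by blast
qed

section \<open>Numbers whose simple prime factors are restricted\<close>

definition all_primes :: "(nat \<Rightarrow> bool) \<Rightarrow> nat \<Rightarrow> bool" where
  "all_primes P n \<longleftrightarrow> n > 0 \<and> (\<forall>p. prime p \<longrightarrow> p dvd n \<longrightarrow> P p)"

text \<open>A prime is constrained only if it divides \<open>n\<close> exactly once. The supports of the multiplicative
  functions considered below have this shape: higher prime powers, and the primes of the modulus
  \<open>r\<close>, are out of control but contribute only a squarefull factor and a divisor of \<open>r\<close>.\<close>
definition simple_primes :: "nat \<Rightarrow> (nat \<Rightarrow> bool) \<Rightarrow> nat \<Rightarrow> bool" where
  "simple_primes r P n \<longleftrightarrow>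
     n > 0 \<and> (\<forall>p. prime p \<longrightarrow> p dvd n \<longrightarrow> \<not> p ^ 2 dvd n \<longrightarrow> p dvd r \<or> P p)"

lemma simple_primes_unitary_divisor:
  assumes "simple_primes r P (q * m)" "coprime q m"
  shows "simple_primes r P m"
  unfolding simple_primes_def
proof (intro conjI allI impI)
  show "m > 0" using assms by (auto simp: simple_primes_def)
  fix p assume p: "prime p" "p dvd m" "\<not> p ^ 2 dvd m"
  then have "\<not> p dvd q"
    using assms(2) by (metis coprime_common_divisor_nat not_prime_1)
  then have "coprime (p ^ 2) q" using p(1) by (simp add: prime_imp_coprime)
  then have "\<not> p ^ 2 dvd q * m" using p(3) by (simp add: coprime_dvd_mult_right_iff)
  then show "p dvd r \<or> P p"
    using assms(1) p by (auto simp: simple_primes_def)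
qed

text \<open>The primes with exponent at least 2 are collected in \<open>b\<close>. Those with exponent 1 that divide \<open>r\<close>
  are collected in \<open>a\<close>, which is therefore a divisor of \<open>r\<close>, and the remaining ones in \<open>m\<close>.\<close>
lemma simple_primes_decompose:
  assumes "simple_primes r P n"
  shows "\<exists>a b m. n = a * b * m \<and> a dvd r \<and> squarefull b \<and> all_primes P m"
proof -
  have "n > 0" using assms by (simp add: simple_primes_def)
  then show ?thesis using assms
  proof (induction n rule: coprime_prime_power_induct)
    case one
    have "squarefull 1" "all_primes P 1"
      by (auto simp: squarefull_def all_primes_def)
    then show ?case by (metis mult_1 one_dvd)
  next
    case (mult p k m)
    have "simple_primes r P m"
      using mult.prems mult.hyps(4) by (auto intro: simple_primes_unitary_divisor)
    then obtain a b t where abt: "m = a * b * t" "a dvd r" "squarefull b" "all_primes P t"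
      using mult.IH by blast
    show ?case
    proof (cases "k = 1")
      case False
      then have k: "k \<ge> 2" using mult.hyps by simp
      have "q ^ 2 dvd p ^ k * b" if q: "prime q" "q dvd p ^ k * b" for q
      proof (cases "q dvd b")
        case True
        then show ?thesis using abt(3) q by (simp add: squarefull_def dvd_mult)
      next
        case False
        then have "q = p"
          using q mult.hyps(1) by (metis prime_dvd_mult_iff prime_dvd_power primes_dvd_imp_eq)
        then show ?thesis using k by (simp add: dvd_mult2 le_imp_power_dvd)
      qed
      then have "squarefull (p ^ k * b)"
        using abt(3) mult.hyps by (simp add: squarefull_def prime_gt_0_nat)
      moreover have "p ^ k * m = a * (p ^ k * b) * t" using abt(1) by simp
      ultimately show ?thesis using abt by blast
    next
      case True
      have "\<not> p dvd m" using mult.hyps by (metis coprime_absorb_left not_prime_unit)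
      then have "\<not> p ^ 2 dvd p ^ k * m"
        using True mult.hyps by (simp add: power2_eq_square)
      then have "p dvd r \<or> P p"
        using mult.prems mult.hyps True by (simp add: simple_primes_def)
      then show ?thesis
      proof
        assume "p dvd r"
        moreover have "coprime p a"
          using mult.hyps(4) abt(1) by (simp add: coprime_mult_right_iff)
        ultimately have "p * a dvd r" using abt(2) by (intro divides_mult)
        moreover have "p ^ k * m = (p * a) * b * t" using abt(1) True by simp
        ultimately show ?thesis using abt by blast
      next
        assume P: "P p"
        have "all_primes P (p * t)"
          unfolding all_primes_def
        proof (intro conjI allI impI)
          show "p * t > 0" using abt(4) mult.hyps by (simp add: all_primes_def prime_gt_0_nat)
          fix q assume "prime q" "q dvd p * t"
          then show "P q"
            using abt(4) P mult.hyps(1)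
            by (metis all_primes_def prime_dvd_mult_iff primes_dvd_imp_eq)
        qed
        moreover have "p ^ k * m = a * b * (p * t)" using abt(1) True by simp
        ultimately show ?thesis using abt by blast
      qed
    qed
  qed
qed

text \<open>Sum over the decomposition \<open>n = a * b * m\<close>: the divisors \<open>a\<close> of \<open>r\<close> number \<open>divisor_count r\<close>, and the
  squarefull factors \<open>b\<close> have a bounded sum, \<open>D\<close> being the constant of \<open>bounded_sum_squarefull\<close>. The exponent \<open>s = 1\<close> will be used for logarithmic sums
  and \<open>s = 3/4\<close> for counting.\<close>
lemma sum_simple_primes_le:
  fixes s :: real
  assumes D: "\<forall>B. finite B \<longrightarrow> (\<forall>b\<in>B. squarefull b) \<longrightarrow> (\<Sum>b\<in>B. real b powr (-3/4)) \<le> D"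
    and "s \<ge> 3/4" "r > 0"
  shows "(\<Sum>n | simple_primes r P n \<and> n \<le> N. real n powr (-s))
       \<le> real (divisor_count r) * D * (\<Sum>m | all_primes P m \<and> m \<le> N. real m powr (-s))"
proof -
  let ?E = "{n. simple_primes r P n \<and> n \<le> N}"
  let ?A = "{a. a dvd r}" and ?B = "{b. squarefull b \<and> b \<le> N}" and ?T = "{m. all_primes P m \<and> m \<le> N}"
  let ?c = "\<lambda>(a, b, m). real a powr (-s) * (real b powr (-s) * real m powr (-s))"
  have fin: "finite ?A" using assms(3) by (rule finite_divisors_nat)
  have "\<forall>n\<in>?E. \<exists>w. w \<in> ?A \<times> ?B \<times> ?T \<and> n = fst w * fst (snd w) * snd (snd w)"
  proof
    fix n assume n: "n \<in> ?E"
    then obtain a b m where w: "n = a * b * m" "a dvd r" "squarefull b" "all_primes P m"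
      using simple_primes_decompose by blast
    moreover have "n > 0" "n \<le> N" using n by (auto simp: simple_primes_def)
    moreover have "b dvd n" "m dvd n" using w by auto
    ultimately have "b \<le> N" "m \<le> N" using dvd_imp_le le_trans by blast+
    then show "\<exists>w. w \<in> ?A \<times> ?B \<times> ?T \<and> n = fst w * fst (snd w) * snd (snd w)"
      using w by (intro exI[of _ "(a, b, m)"]) auto
  qed
  from bchoice[OF this] obtain g
    where g: "\<forall>n\<in>?E. g n \<in> ?A \<times> ?B \<times> ?T \<and> n = fst (g n) * fst (snd (g n)) * snd (snd (g n))"
    by blast
  have g': "fst (g n) * fst (snd (g n)) * snd (snd (g n)) = n" if "n \<in> ?E" for n
    using g that by metis
  have inj: "inj_on g ?E"
  proof (rule inj_onI)
    fix x y assume "x \<in> ?E" "y \<in> ?E" "g x = g y"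
    then show "x = y" using g'[of x] g'[of y] by metis
  qed
  have "(\<Sum>n\<in>?E. real n powr (-s)) = (\<Sum>n\<in>?E. ?c (g n))"
  proof (rule sum.cong[OF refl])
    fix n assume "n \<in> ?E"
    then have "real n = real (fst (g n)) * real (fst (snd (g n))) * real (snd (snd (g n)))"
      using g'[of n] by (metis of_nat_mult)
    then show "real n powr (-s) = ?c (g n)"
      by (simp add: powr_mult case_prod_unfold)
  qed
  also have "\<dots> = (\<Sum>w\<in>g ` ?E. ?c w)" by (simp add: sum.reindex[OF inj])
  also have "\<dots> \<le> (\<Sum>w\<in>?A \<times> ?B \<times> ?T. ?c w)"
  proof (rule sum_mono2)
    show "g ` ?E \<subseteq> ?A \<times> ?B \<times> ?T" using g by blast
  qed (use fin in \<open>auto simp: case_prod_unfold\<close>)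
  also have "\<dots> = (\<Sum>a\<in>?A. real a powr (-s)) * ((\<Sum>b\<in>?B. real b powr (-s)) * (\<Sum>m\<in>?T. real m powr (-s)))"
    by (simp add: sum_product sum.cartesian_product case_prod_unfold)
  also have "\<dots> \<le> real (divisor_count r) * (D * (\<Sum>m\<in>?T. real m powr (-s)))"
  proof (intro mult_mono)
    have "(\<Sum>a\<in>?A. real a powr (-s)) \<le> (\<Sum>a\<in>?A. 1)"
    proof (rule sum_mono)
      fix a assume "a \<in> ?A"
      then have "a \<ge> 1" using assms(3) by (auto intro: Nat.gr0I simp: Suc_le_eq)
      then show "real a powr (-s) \<le> 1"
        using powr_mono[of "-s" 0 "real a"] assms(2) by simp
    qed
    then show "(\<Sum>a\<in>?A. real a powr (-s)) \<le> real (divisor_count r)"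
      by (simp add: divisor_count_def)
    have "(\<Sum>b\<in>?B. real b powr (-s)) \<le> (\<Sum>b\<in>?B. real b powr (-3/4))"
      using assms(2) by (intro sum_mono powr_mono) (auto simp: squarefull_def)
    also have "\<dots> \<le> D" by (rule D[rule_format]) auto
    finally show "(\<Sum>b\<in>?B. real b powr (-s)) \<le> D" .
    show "D \<ge> 0" using D[rule_format, of "{}"] by simp
  qed (auto intro!: sum_nonneg mult_nonneg_nonneg)
  finally show ?thesis by (simp add: mult.assoc)
qed

section \<open>An upper bound of Halberstam--Richert type\<close>

definition unitary_prime_powers :: "nat \<Rightarrow> nat set" where
  "unitary_prime_powers n = {q. prime_power q \<and> q dvd n \<and> coprime q (n div q)}"

lemma finite_unitary_prime_powers: "n > 0 \<Longrightarrow> finite (unitary_prime_powers n)"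
  by (rule finite_subset[OF _ finite_divisors_nat]) (auto simp: unitary_prime_powers_def)

lemma prime_power_ge_1: "prime_power q \<Longrightarrow> q \<ge> 1"
  by (auto simp: prime_power_def prime_gt_0_nat Suc_le_eq)

text \<open>\<open>n\<close> is the product of its unitary prime powers.\<close>
lemma ln_le_sum_unitary_prime_powers:
  assumes "n > 0"
  shows "ln (real n) \<le> (\<Sum>q\<in>unitary_prime_powers n. ln (real q))"
  using assms
proof (induction n rule: coprime_prime_power_induct)
  case one
  then show ?case by (auto intro!: sum_nonneg simp: unitary_prime_powers_def dest: prime_power_ge_1)
next
  case (mult p k m)
  let ?q = "p ^ k"
  have q: "prime_power ?q" "?q > 0" "coprime ?q m"
    using mult.hyps by (auto simp: prime_power_def prime_gt_0_nat)
  have "\<not> ?q dvd m"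
    using mult.hyps by (metis coprime_absorb_left coprime_power_left_iff neq0_conv not_prime_unit is_unit_power_iff)
  then have notin: "?q \<notin> unitary_prime_powers m" by (simp add: unitary_prime_powers_def)
  have sub: "insert ?q (unitary_prime_powers m) \<subseteq> unitary_prime_powers (?q * m)"
  proof -
    have "?q \<in> unitary_prime_powers (?q * m)" using q by (simp add: unitary_prime_powers_def)
    moreover have "x \<in> unitary_prime_powers (?q * m)" if x: "x \<in> unitary_prime_powers m" for x
    proof -
      have "x dvd m" "coprime x (m div x)" "prime_power x"
        using x by (auto simp: unitary_prime_powers_def)
      moreover from this have "?q * m div x = ?q * (m div x)" by (simp add: div_mult_swap)
      moreover have "coprime x ?q" using q(3) \<open>x dvd m\<close>
        by (metis coprime_commute coprime_divisors dvd_refl)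
      ultimately show ?thesis by (simp add: unitary_prime_powers_def)
    qed
    ultimately show ?thesis by blast
  qed
  have "ln (real (?q * m)) = ln (real ?q) + ln (real m)"
    using q(2) mult.hyps(3) by (simp add: ln_mult)
  also have "\<dots> \<le> ln (real ?q) + (\<Sum>q\<in>unitary_prime_powers m. ln (real q))"
    using mult.IH by simp
  also have "\<dots> = (\<Sum>q\<in>insert ?q (unitary_prime_powers m). ln (real q))"
    using notin mult.hyps(3) by (simp add: finite_unitary_prime_powers)
  also have "\<dots> \<le> (\<Sum>q\<in>unitary_prime_powers (?q * m). ln (real q))"
  proof (rule sum_mono2[OF _ sub])
    show "finite (unitary_prime_powers (?q * m))"
      using q mult.hyps(3) by (intro finite_unitary_prime_powers) simp
    show "0 \<le> ln (real b)" if "b \<in> unitary_prime_powers (?q * m) - insert ?q (unitary_prime_powers m)" for b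
      using that prime_power_ge_1 by (simp add: unitary_prime_powers_def)
  qed
  finally show ?case .
qed

text \<open>This bounds a counting function by a logarithmic sum, saving the factor \<open>ln N\<close>. Write
  \<open>ln N = ln n + ln (N / n)\<close>. The second part is at most \<open>N / n\<close>. The first part is a sum of \<open>ln q\<close> over
  the unitary prime powers \<open>q\<close> of \<open>n = q * m\<close>; since \<open>Q\<close> passes to \<open>m\<close>, summing over \<open>q \<le> N / m\<close> first and
  using Chebyshev's bound leaves a multiple of \<open>N / m\<close>.\<close>
lemma card_mult_ln_le:
  fixes Q :: "nat \<Rightarrow> bool"
  assumes A: "\<forall>n. (\<Sum>q | prime_power q \<and> q \<le> n. ln (real q)) \<le> A * real n" "A \<ge> 0"
    and pos: "\<And>n. Q n \<Longrightarrow> n > 0"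
    and closed: "\<And>q m. coprime q m \<Longrightarrow> Q (q * m) \<Longrightarrow> Q m"
    and N: "N \<ge> 1"
  shows "real (card {n. Q n \<and> n \<le> N}) * ln (real N)
       \<le> (A + 1) * real N * (\<Sum>n | Q n \<and> n \<le> N. 1 / real n)"
proof -
  let ?E = "{n. Q n \<and> n \<le> N}"
  let ?U = "SIGMA n:?E. unitary_prime_powers n"
  let ?V = "SIGMA m:?E. {q. prime_power q \<and> q \<le> N div m}"
  have finU: "finite ?U" using pos by (auto intro!: finite_SigmaI finite_unitary_prime_powers)
  have inj: "inj_on (\<lambda>(n, q). (n div q, q)) ?U"
    by (rule inj_onI) (auto simp: unitary_prime_powers_def, metis dvd_div_mult_self)
  have img: "(\<lambda>(n, q). (n div q, q)) ` ?U \<subseteq> ?V"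
  proof
    fix z assume "z \<in> (\<lambda>(n, q). (n div q, q)) ` ?U"
    then obtain n q where z: "z = (n div q, q)" "Q n" "n \<le> N" "prime_power q" "q dvd n" "coprime q (n div q)"
      by (auto simp: unitary_prime_powers_def)
    have n: "q * (n div q) = n" using z by simp
    then have "Q (n div q)" using closed z by metis
    moreover have "n div q \<le> N" using z by (meson div_le_dividend le_trans)
    moreover have "q * (n div q) \<le> N" using n z by simp
    then have "q \<le> N div (n div q)"
      using pos[OF \<open>Q (n div q)\<close>] by (simp add: less_eq_div_iff_mult_less_eq)
    ultimately show "z \<in> ?V" using z by auto
  qed
  have "(\<Sum>n\<in>?E. ln (real n)) \<le> (\<Sum>n\<in>?E. \<Sum>q\<in>unitary_prime_powers n. ln (real q))"
    using pos by (intro sum_mono ln_le_sum_unitary_prime_powers) auto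
  also have "\<dots> = (\<Sum>(n, q)\<in>?U. ln (real q))"
    using pos by (intro sum.Sigma) (auto intro: finite_unitary_prime_powers)
  also have "\<dots> = (\<Sum>(m, q)\<in>(\<lambda>(n, q). (n div q, q)) ` ?U. ln (real q))"
    by (subst sum.reindex[OF inj]) (simp add: case_prod_unfold)
  also have "\<dots> \<le> (\<Sum>(m, q)\<in>?V. ln (real q))"
    using img by (rule sum_mono2[rotated]) (auto dest: prime_power_ge_1)
  also have "\<dots> = (\<Sum>m\<in>?E. \<Sum>q | prime_power q \<and> q \<le> N div m. ln (real q))"
    by (intro sum.Sigma[symmetric]) auto
  also have "\<dots> \<le> (\<Sum>m\<in>?E. A * (real N / real m))"
  proof (rule sum_mono)
    fix m
    have "(\<Sum>q | prime_power q \<and> q \<le> N div m. ln (real q)) \<le> A * real (N div m)"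
      using A(1) by blast
    also have "\<dots> \<le> A * (real N / real m)"
      using A(2) by (intro mult_left_mono of_nat_div_le_of_nat)
    finally show "(\<Sum>q | prime_power q \<and> q \<le> N div m. ln (real q)) \<le> A * (real N / real m)" .
  qed
  finally have *: "(\<Sum>n\<in>?E. ln (real n)) \<le> (\<Sum>m\<in>?E. A * (real N / real m))" .
  have "real (card ?E) * ln (real N) = (\<Sum>n\<in>?E. ln (real n) + ln (real N / real n))"
  proof -
    have "ln (real n) + ln (real N / real n) = ln (real N)" if "n \<in> ?E" for n
      using pos that N by (simp add: ln_div)
    then show ?thesis by simp
  qed
  also have "\<dots> \<le> (\<Sum>n\<in>?E. ln (real n)) + (\<Sum>n\<in>?E. real N / real n)"
    unfolding sum.distrib
  proof (intro add_left_mono sum_mono)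
    fix n assume "n \<in> ?E"
    then have "real N / real n > 0" using pos N by simp
    then show "ln (real N / real n) \<le> real N / real n"
      using ln_le_minus_one by fastforce
  qed
  also have "\<dots> \<le> (\<Sum>n\<in>?E. A * (real N / real n)) + (\<Sum>n\<in>?E. real N / real n)"
    using * by simp
  also have "\<dots> = (A + 1) * real N * (\<Sum>n\<in>?E. 1 / real n)"
    by (simp add: sum_distrib_left sum_distrib_right distrib_right add_divide_distrib sum.distrib)
  finally show ?thesis .
qed

section \<open>Real characters modulo 8\<close>

text \<open>Odd squares are 1 modulo 8, so all Dirichlet characters modulo 8 take real values. By periodicity
  nothing is lost in viewing them as functions on the natural numbers.\<close>
definition real_char8 :: "(nat \<Rightarrow> real) \<Rightarrow> bool" where
  "real_char8 \<psi> \<longleftrightarrow> (\<forall>a b. \<psi> (a * b) = \<psi> a * \<psi> b) \<and> (\<forall>n. \<psi> (n + 8) = \<psi> n) \<and>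
     (\<forall>n. \<psi> n = 0 \<longleftrightarrow> even n)"

lemma real_char8_mod:
  assumes "real_char8 \<psi>"
  shows "\<psi> (n mod 8) = \<psi> n"
proof -
  have "\<psi> (m + 8 * k) = \<psi> m" for m k
  proof (induction k)
    case (Suc k)
    then show ?case
      using assms by (simp add: real_char8_def) (metis add.assoc add.commute)
  qed simp
  from this[of "n mod 8" "n div 8"] show ?thesis by simp
qed

lemma real_char8_one: "real_char8 \<psi> \<Longrightarrow> \<psi> (Suc 0) = 1"
  unfolding real_char8_def by (metis One_nat_def mult_cancel_left2 nat_mult_1 odd_one)

lemma real_char8_mult: "real_char8 \<psi> \<Longrightarrow> \<psi> (a * b) = \<psi> a * \<psi> b"
  by (simp add: real_char8_def)

lemma real_char8_power: "real_char8 \<psi> \<Longrightarrow> \<psi> (a ^ k) = \<psi> a ^ k"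
  by (induction k) (simp_all add: real_char8_one real_char8_mult)

lemma real_char8_zero_iff: "real_char8 \<psi> \<Longrightarrow> \<psi> n = 0 \<longleftrightarrow> even n"
  by (simp add: real_char8_def)

lemma real_char8_values:
  assumes "real_char8 \<psi>"
  shows "\<psi> n = -1 \<or> \<psi> n = 0 \<or> \<psi> n = 1"
proof (cases "even n")
  case False
  then have "n mod 8 = 1 \<or> n mod 8 = 3 \<or> n mod 8 = 5 \<or> n mod 8 = 7" by presburger
  then have "(n * n) mod 8 = 1"
    by (elim disjE) (simp_all add: mod_mult_eq[of n 8 n, symmetric])
  then have "\<psi> (n * n) = 1"
    using real_char8_mod[OF assms, of "n * n"] real_char8_one[OF assms] by simp
  then have "\<psi> n * \<psi> n = 1" using real_char8_mult[OF assms] by simp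
  then show ?thesis using square_eq_1_iff by blast
qed (use assms in \<open>simp add: real_char8_zero_iff\<close>)

lemma real_char8_abs_le: "real_char8 \<psi> \<Longrightarrow> \<bar>\<psi> n\<bar> \<le> 1"
  using real_char8_values[of \<psi> n] by auto

lemma multiplicative_real_char8: "real_char8 \<psi> \<Longrightarrow> multiplicative \<psi>"
  by (simp add: multiplicative_def real_char8_mult real_char8_one)

lemma real_char8_prod: "real_char8 \<psi> \<Longrightarrow> real_char8 \<phi> \<Longrightarrow> real_char8 (\<lambda>n. \<psi> n * \<phi> n)"
  by (simp add: real_char8_def)

text \<open>The group of units modulo 8 is generated by 3 and 5, so the sum over a period factors as
  \<open>(1 + \<psi> 3) * (1 + \<psi> 5)\<close>, and a nonprincipal character is \<open>-1\<close> at one of the two generators.\<close>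
lemma real_char8_period_sum:
  assumes \<psi>: "real_char8 \<psi>" and "\<psi> a = -1"
  shows "(\<Sum>n<8. \<psi> n) = 0"
proof -
  have "\<psi> (3 * 5) = \<psi> 7" using real_char8_mod[OF \<psi>, of "3 * 5"] by simp
  then have 7: "\<psi> 7 = \<psi> 3 * \<psi> 5" using \<psi> by (simp only: real_char8_mult)
  have "odd a" using assms by (metis neg_equal_0_iff_equal real_char8_zero_iff zero_neq_one)
  then have "a mod 8 = 1 \<or> a mod 8 = 3 \<or> a mod 8 = 5 \<or> a mod 8 = 7" by presburger
  then have "\<psi> 3 = -1 \<or> \<psi> 5 = -1 \<or> \<psi> 7 = -1"
    using assms(2) real_char8_mod[OF \<psi>, of a] real_char8_one[OF \<psi>] by (elim disjE) auto
  then have "\<psi> 3 = -1 \<or> \<psi> 5 = -1"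
    using 7 real_char8_values[OF \<psi>, of 3] real_char8_values[OF \<psi>, of 5] by auto
  moreover have "(\<Sum>n<8. \<psi> n) = (1 + \<psi> 3) * (1 + \<psi> 5)"
  proof -
    have "{..<8} = {0, 1, 2, 3, 4, 5, 6, 7::nat}" by auto
    moreover have "\<psi> 0 = 0" "\<psi> 2 = 0" "\<psi> 4 = 0" "\<psi> 6 = 0"
      using \<psi> by (simp_all add: real_char8_zero_iff)
    ultimately show ?thesis
      using 7 real_char8_one[OF \<psi>] by (simp add: algebra_simps)
  qed
  ultimately show ?thesis by auto
qed

lemma real_char8_partial_sum_bound:
  assumes \<psi>: "real_char8 \<psi>" and "\<psi> a = -1"
  shows "\<bar>\<Sum>n=1..N. \<psi> n\<bar> \<le> 8"
proof -
  have per: "(\<Sum>n<N + 8. \<psi> n) = (\<Sum>n<N. \<psi> n)" for N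
  proof (induction N)
    case 0
    then show ?case using real_char8_period_sum[OF assms] by simp
  next
    case (Suc N)
    have "(\<Sum>n<Suc N + 8. \<psi> n) = (\<Sum>n<N + 8. \<psi> n) + \<psi> (N + 8)"
      by (simp only: add_Suc sum.lessThan_Suc)
    also have "\<dots> = (\<Sum>n<Suc N. \<psi> n)"
      using Suc \<psi> by (simp add: real_char8_def)
    finally show ?case .
  qed
  have bound: "\<bar>\<Sum>n<N. \<psi> n\<bar> \<le> 8" for N
  proof (induction N rule: less_induct)
    case (less N)
    show ?case
    proof (cases "N < 8")
      case True
      have "\<bar>\<Sum>n<N. \<psi> n\<bar> \<le> (\<Sum>n<N. \<bar>\<psi> n\<bar>)" by (rule sum_abs)
      also have "\<dots> \<le> (\<Sum>n<N. 1)" by (intro sum_mono real_char8_abs_le \<psi>)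
      finally show ?thesis using True by simp
    next
      case False
      then show ?thesis using less[of "N - 8"] per[of "N - 8"] by simp
    qed
  qed
  have "(\<Sum>n=1..N. \<psi> n) = (\<Sum>n<Suc N. \<psi> n)"
    using \<psi> by (intro sum.mono_neutral_left) (auto simp: real_char8_zero_iff not_less_eq_eq)
  then show ?thesis using bound[of "Suc N"] by (simp only:)
qed

lemma abel_summation_inverse:
  fixes f :: "nat \<Rightarrow> real"
  shows "(\<Sum>n=1..N. f n / real n)
       = (\<Sum>n=1..N. f n) / real (Suc N)
         + (\<Sum>n=1..N. (\<Sum>k=1..n. f k) * (1 / real n - 1 / real (Suc n)))"
proof (induction N)
  case (Suc N)
  have alg: "(S / x + A) + t / x = (S + t) / y + (A + (S + t) * (1 / x - 1 / y))" for S A t x y :: real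
    by (simp add: algebra_simps add_divide_distrib)
  have last: "(\<Sum>n=1..Suc N. h n) = (\<Sum>n=1..N. h n) + h (Suc N)" for h :: "nat \<Rightarrow> real"
    by simp
  show ?case by (simp only: last Suc.IH alg)
qed simp

lemma sum_inverse_differences: "(\<Sum>n=1..N. 1 / real n - 1 / real (Suc n)) = 1 - 1 / real (Suc N)"
  by (induction N) simp_all

lemma real_char8_harmonic_sum_bound:
  assumes "real_char8 \<psi>" and "\<psi> a = -1"
  shows "\<bar>\<Sum>n=1..N. \<psi> n / real n\<bar> \<le> 8"
proof -
  let ?P = "\<lambda>n. \<Sum>k=1..n. \<psi> k"
  have "\<bar>\<Sum>n=1..N. \<psi> n / real n\<bar>
      \<le> \<bar>?P N / real (Suc N)\<bar> + \<bar>\<Sum>n=1..N. ?P n * (1 / real n - 1 / real (Suc n))\<bar>"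
    unfolding abel_summation_inverse by (rule abs_triangle_ineq)
  also have "\<bar>?P N / real (Suc N)\<bar> \<le> 8 / real (Suc N)"
    using real_char8_partial_sum_bound[OF assms, of N] by (simp add: divide_right_mono)
  also have "\<bar>\<Sum>n=1..N. ?P n * (1 / real n - 1 / real (Suc n))\<bar>
      \<le> (\<Sum>n=1..N. 8 * (1 / real n - 1 / real (Suc n)))"
  proof (rule order_trans[OF sum_abs], rule sum_mono)
    fix n assume "n \<in> {1..N}"
    then have "1 / real n - 1 / real (Suc n) \<ge> 0" by (simp add: frac_le)
    then show "\<bar>?P n * (1 / real n - 1 / real (Suc n))\<bar> \<le> 8 * (1 / real n - 1 / real (Suc n))"
      using real_char8_partial_sum_bound[OF assms, of n]
      by (simp only: abs_mult abs_of_nonneg) (rule mult_right_mono)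
  qed
  also have "(\<Sum>n=1..N. 8 * (1 / real n - 1 / real (Suc n))) = 8 * (1 - 1 / real (Suc N))"
    by (simp only: sum_distrib_left[symmetric] sum_inverse_differences)
  finally show ?thesis by (simp add: algebra_simps)
qed

section \<open>Integers composed of the primes where a character is 1\<close>

lemma all_primes_dvd:
  assumes "d dvd n" "all_primes P n"
  shows "all_primes P d"
  using assms dvd_pos_nat dvd_trans unfolding all_primes_def by blast

lemma real_char8_eq_1_if_all_primes:
  assumes \<psi>: "real_char8 \<psi>" and "all_primes (\<lambda>p. \<psi> p = 1) n"
  shows "\<psi> n = 1"
proof -
  have "n > 0" using assms(2) by (simp add: all_primes_def)
  then show ?thesis using assms(2)
  proof (induction n rule: coprime_prime_power_induct)
    case (mult p k m)
    then have "all_primes (\<lambda>p. \<psi> p = 1) m" "\<psi> p = 1"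
      by (auto simp: all_primes_def)
    then show ?case using mult.IH \<psi> by (simp add: real_char8_mult real_char8_power)
  qed (use \<psi> in \<open>simp add: real_char8_one\<close>)
qed

text \<open>At a prime power the value is \<open>1 + x + x\<^sup>2 + \<dots>\<close> with \<open>x = \<psi> p\<close> in \<open>{-1, 0, 1}\<close>, and such
  partial geometric sums are nonnegative.\<close>
lemma dconv_one_real_char8_nonneg:
  assumes \<psi>: "real_char8 \<psi>" and "n > 0"
  shows "dconv (\<lambda>_. 1) \<psi> n \<ge> 0"
  using \<open>n > 0\<close>
proof (induction n rule: coprime_prime_power_induct)
  case one
  then show ?case using \<psi> by (simp add: dconv_def real_char8_one)
next
  case (mult p k m)
  have M: "multiplicative (dconv (\<lambda>_. 1) \<psi>)"
    using multiplicative_real_char8[OF \<psi>] by (intro multiplicative_dconv) (simp_all add: multiplicative_def)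
  have "dconv (\<lambda>_. 1) \<psi> (p ^ k) = (\<Sum>i\<le>k. \<psi> (p ^ (k - i)))"
    using mult.hyps(1)
    by (simp add: dconv_def sum_divisors_prime_power power_diff prime_gt_0_nat)
  also have "\<dots> = (\<Sum>i\<le>k. \<psi> p ^ i)"
    using \<psi> by (intro sum.reindex_bij_witness[of _ "\<lambda>i. k - i" "\<lambda>i. k - i"])
      (auto simp: real_char8_power)
  also have "\<dots> \<ge> 0"
  proof -
    have "(\<Sum>i\<le>k. (-1::real) ^ i) = (if even k then 1 else 0)" by (induction k) auto
    then have "(\<Sum>i\<le>k. (-1::real) ^ i) \<ge> 0" by simp
    moreover have "(\<Sum>i\<le>k. x ^ i) \<ge> 0" if "x = 0 \<or> x = 1" for x :: real
      using that by (intro sum_nonneg) auto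
    ultimately show ?thesis
      using real_char8_values[OF \<psi>, of p] by metis
  qed
  finally show ?case
    using M mult.IH mult.hyps by (simp add: multiplicativeD prime_gt_0_nat)
qed

lemma harmonic_sum_le_ln: "N \<ge> 1 \<Longrightarrow> (\<Sum>d=1..N. 1 / real d) \<le> 1 + ln (real N)"
proof (induction N rule: dec_induct)
  case (step N)
  have "ln (real N / real (Suc N)) \<le> real N / real (Suc N) - 1"
    using step by (intro ln_le_minus_one) simp
  also have "\<dots> = - (1 / real (Suc N))" by (simp add: field_simps)
  finally have "1 / real (Suc N) \<le> ln (real (Suc N)) - ln (real N)"
    using step by (simp add: ln_div)
  moreover have "(\<Sum>d=1..Suc N. 1 / real d) = (\<Sum>d=1..N. 1 / real d) + 1 / real (Suc N)" by simp
  ultimately show ?case using step.IH by linarith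
qed simp

text \<open>Summing over the factor that carries \<open>\<psi>\<close> first gives bounded inner sums, so that only one harmonic
  sum remains, where the trivial bound would give two.\<close>
lemma sum_dconv_one_real_char8_le:
  assumes "real_char8 \<psi>" and "\<psi> a = -1" and "N \<ge> 1"
  shows "(\<Sum>n=1..N. dconv (\<lambda>_. 1) \<psi> n / real n) \<le> 8 * (1 + ln (real N))"
proof -
  have "(\<Sum>n=1..N. dconv (\<lambda>_. 1) \<psi> n / real n)
      = (\<Sum>n=1..N. \<Sum>d | d dvd n. 1 / real d * (\<psi> (n div d) / real (n div d)))"
    by (intro sum.cong refl) (auto simp: dconv_def sum_divide_distrib real_of_nat_div intro!: sum.cong)
  also have "\<dots> = (\<Sum>d=1..N. \<Sum>m=1..N div d. 1 / real d * (\<psi> m / real m))"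
    by (rule sum_divisors_swap)
  also have "\<dots> \<le> (\<Sum>d=1..N. 1 / real d * 8)"
  proof (rule sum_mono)
    fix d
    have "(\<Sum>m=1..N div d. \<psi> m / real m) \<le> 8"
      using real_char8_harmonic_sum_bound[OF assms(1,2), of "N div d"] by linarith
    then show "(\<Sum>m=1..N div d. 1 / real d * (\<psi> m / real m)) \<le> 1 / real d * 8"
      unfolding sum_distrib_left[symmetric] by (rule mult_left_mono) simp
  qed
  also have "\<dots> = 8 * (\<Sum>d=1..N. 1 / real d)"
    by (simp add: sum_distrib_left)
  also have "(\<Sum>d=1..N. 1 / real d) \<le> 1 + ln (real N)"
    using assms(3) by (rule harmonic_sum_le_ln)
  finally show ?thesis by simp
qed

text \<open>The primes with \<open>\<psi> p = 1\<close> make up half of all primes, which should make this sum of order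
  \<open>sqrt (ln N)\<close>. Its square makes this visible: the number of
  ways to write \<open>n\<close> as a product \<open>m * m'\<close> is at most the number of divisors of \<open>n\<close>. For \<open>n\<close>
  composed of such primes this equals \<open>\<Sum>d | d dvd n. \<psi> d\<close>. By nonnegativity the range can be
  extended to all \<open>n \<le> N\<^sup>2\<close>, where the sum is at most of order \<open>ln N\<close>.\<close>
lemma sum_all_primes_char_le:
  assumes \<psi>: "real_char8 \<psi>" and a: "\<psi> a = -1" and N: "N \<ge> 1"
  shows "(\<Sum>m | all_primes (\<lambda>p. \<psi> p = 1) m \<and> m \<le> N. 1 / real m) \<le> sqrt (16 * (1 + ln (real N)))"
proof -
  let ?T = "{m. all_primes (\<lambda>p. \<psi> p = 1) m \<and> m \<le> N}"
  let ?T2 = "{n. all_primes (\<lambda>p. \<psi> p = 1) n \<and> n \<le> N\<^sup>2}"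
  let ?V = "SIGMA n:?T2. {d. d dvd n}"
  let ?R = "dconv (\<lambda>_. 1) \<psi>"
  have T2: "n > 0" if "n \<in> ?T2" for n using that by (auto simp: all_primes_def)
  have finV: "finite ?V" using T2 by (intro finite_SigmaI finite_divisors_nat) auto
  have inj: "inj_on (\<lambda>(m, m'). (m * m', m)) (?T \<times> ?T)"
    by (auto simp: inj_on_def all_primes_def)
  have img: "(\<lambda>(m, m'). (m * m', m)) ` (?T \<times> ?T) \<subseteq> ?V"
    by (auto simp: all_primes_def prime_dvd_mult_iff power2_eq_square mult_le_mono)
  have "(\<Sum>m\<in>?T. 1 / real m)\<^sup>2 = (\<Sum>(m, m')\<in>?T \<times> ?T. 1 / real (m * m'))"
    by (simp add: power2_eq_square sum_product sum.cartesian_product)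
  also have "\<dots> = (\<Sum>(n, d)\<in>(\<lambda>(m, m'). (m * m', m)) ` (?T \<times> ?T). 1 / real n)"
    by (subst sum.reindex[OF inj]) (simp add: case_prod_unfold)
  also have "\<dots> \<le> (\<Sum>(n, d)\<in>?V. 1 / real n)"
    using img finV by (intro sum_mono2) auto
  also have "\<dots> = (\<Sum>n\<in>?T2. \<Sum>d | d dvd n. 1 / real n)"
    using T2 by (intro sum.Sigma[symmetric]) (auto intro: finite_divisors_nat)
  also have "\<dots> = (\<Sum>n\<in>?T2. ?R n / real n)"
  proof (rule sum.cong[OF refl])
    fix n assume n: "n \<in> ?T2"
    have "\<psi> (n div d) = 1" if "d dvd n" for d
    proof (rule real_char8_eq_1_if_all_primes[OF \<psi>])
      have "n div d dvd n" using that by (metis dvd_mult_div_cancel dvd_triv_right)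
      moreover have "all_primes (\<lambda>p. \<psi> p = 1) n" using n by simp
      ultimately show "all_primes (\<lambda>p. \<psi> p = 1) (n div d)" by (rule all_primes_dvd)
    qed
    then show "(\<Sum>d | d dvd n. 1 / real n) = ?R n / real n"
      by (simp add: dconv_def)
  qed
  also have "\<dots> \<le> (\<Sum>n=1..N\<^sup>2. ?R n / real n)"
    using T2 by (intro sum_mono2) (auto simp: Suc_le_eq intro!: divide_nonneg_nonneg dconv_one_real_char8_nonneg[OF \<psi>])
  also have "\<dots> \<le> 8 * (1 + ln (real (N\<^sup>2)))"
    using N by (intro sum_dconv_one_real_char8_le[OF \<psi> a]) simp
  also have "\<dots> \<le> 16 * (1 + ln (real N))"
    using N by (simp add: ln_realpow)
  finally show ?thesis by (rule real_le_rsqrt)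
qed

section \<open>Summing multiplicative functions by Moebius differences\<close>

text \<open>For multiplicative \<open>g\<close> this is the Dirichlet convolution of \<open>g\<close> with the Moebius function, given
  directly by its Euler product.\<close>
definition prime_power_difference :: "(nat \<Rightarrow> real) \<Rightarrow> nat \<Rightarrow> real" where
  "prime_power_difference g n =
     (\<Prod>p\<in>prime_factors n. g (p ^ multiplicity p n) - g (p ^ (multiplicity p n - 1)))"

lemma prime_power_difference_prime_power:
  assumes "prime p" "k > 0"
  shows "prime_power_difference g (p ^ k) = g (p ^ k) - g (p ^ (k - 1))"
proof -
  have "prime_factors (p ^ k) = {p}"
    using assms by (simp add: prime_factorization_prime_power)
  then show ?thesis using assms(1) by (simp add: prime_power_difference_def)
qed

lemma multiplicative_prime_power_difference: "multiplicative (prime_power_difference g)"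
  unfolding multiplicative_def
proof (intro conjI allI impI)
  show "prime_power_difference g 1 = 1" by (simp add: prime_power_difference_def)
  fix a b :: nat assume ab: "a > 0" "b > 0" "coprime a b"
  have disj: "prime_factors a \<inter> prime_factors b = {}"
    using ab(3) by (auto simp: in_prime_factors_iff coprime_common_divisor_nat dest: coprime_common_divisor)
  have *: "multiplicity p (x * y) = multiplicity p x" if "p \<in> prime_factors x" "coprime x y" "x > 0" "y > 0" for p x y :: nat
  proof -
    have "\<not> p dvd y" using that by (metis coprime_common_divisor in_prime_factors_iff not_prime_unit)
    then show ?thesis
      using that by (auto simp: prime_elem_multiplicity_mult_distrib in_prime_factors_iff not_dvd_imp_multiplicity_0)
  qed
  let ?h = "\<lambda>n p. g (p ^ multiplicity p n) - g (p ^ (multiplicity p n - 1))"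
  have "prime_power_difference g (a * b) = (\<Prod>p\<in>prime_factors a \<union> prime_factors b. ?h (a * b) p)"
    using ab by (simp add: prime_power_difference_def prime_factors_product)
  also have "\<dots> = (\<Prod>p\<in>prime_factors a. ?h (a * b) p) * (\<Prod>p\<in>prime_factors b. ?h (a * b) p)"
    using disj by (intro prod.union_disjoint) auto
  also have "(\<Prod>p\<in>prime_factors a. ?h (a * b) p) = prime_power_difference g a"
    using ab * unfolding prime_power_difference_def by (intro prod.cong) auto
  also have "(\<Prod>p\<in>prime_factors b. ?h (a * b) p) = prime_power_difference g b"
    using ab *[of _ b a] unfolding prime_power_difference_def
    by (intro prod.cong) (auto simp: mult.commute coprime_commute)
  finally show "prime_power_difference g (a * b) = prime_power_difference g a * prime_power_difference g b" .
qed

text \<open>Both sides are multiplicative, and at a prime power the sum telescopes.\<close>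
lemma sum_divisors_prime_power_difference:
  assumes g: "multiplicative g" and "n > 0"
  shows "(\<Sum>d | d dvd n. prime_power_difference g d) = g n"
proof -
  have "dconv (prime_power_difference g) (\<lambda>_. 1) n = g n"
  proof (rule multiplicative_eqI[OF _ g \<open>n > 0\<close>])
    show "multiplicative (dconv (prime_power_difference g) (\<lambda>_. 1))"
      by (intro multiplicative_dconv multiplicative_prime_power_difference) (simp add: multiplicative_def)
    fix p k :: nat assume p: "prime p" and "k > 0"
    have "(\<Sum>i\<le>k. prime_power_difference g (p ^ i)) = g (p ^ k)"
    proof (induction k)
      case 0
      then show ?case using g by (simp add: prime_power_difference_def multiplicative_def)
    next
      case (Suc k)
      then show ?case using prime_power_difference_prime_power[OF p, of "Suc k" g] by simp
    qed
    then show "dconv (prime_power_difference g) (\<lambda>_. 1) (p ^ k) = g (p ^ k)"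
      by (simp add: dconv_def sum_divisors_prime_power[OF p])
  qed
  then show ?thesis by (simp add: dconv_def)
qed

lemma abs_prime_power_difference_le:
  assumes "\<And>n. n > 0 \<Longrightarrow> 0 \<le> g n \<and> g n \<le> 1"
  shows "\<bar>prime_power_difference g n\<bar> \<le> 1"
proof -
  have "\<bar>g (p ^ i) - g (p ^ j)\<bar> \<le> 1" if "p \<in> prime_factors n" for p i j
  proof -
    have "p ^ i > 0" "p ^ j > 0" using that by (auto simp: in_prime_factors_iff prime_gt_0_nat)
    then show ?thesis using assms[of "p ^ i"] assms[of "p ^ j"] by linarith
  qed
  then show ?thesis
    unfolding prime_power_difference_def abs_prod by (intro prod_le_1) auto
qed

text \<open>A prime \<open>p\<close> that divides \<open>n\<close> exactly once contributes the factor \<open>g p - g 1\<close>.\<close>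
lemma simple_primes_if_prime_power_difference_nonzero:
  assumes "prime_power_difference g n \<noteq> 0" "n > 0" "g 1 = 1"
    and "\<And>p. prime p \<Longrightarrow> \<not> p dvd r \<Longrightarrow> g p = 1"
  shows "simple_primes r (\<lambda>_. False) n"
  unfolding simple_primes_def
proof (intro conjI allI impI disjI1)
  fix p assume p: "prime p" "p dvd n" "\<not> p ^ 2 dvd n"
  have "multiplicity p n = 1"
  proof (rule multiplicity_eqI)
    show "p ^ 1 dvd n" using p by simp
    show "\<not> p ^ Suc 1 dvd n" using p(3) by (simp add: power2_eq_square)
  qed
  moreover have "p \<in> prime_factors n" using p assms(2) by (simp add: in_prime_factors_iff)
  then have "g (p ^ multiplicity p n) - g (p ^ (multiplicity p n - 1)) \<noteq> 0"
    using assms(1) by (auto simp: prime_power_difference_def prod_zero_iff)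
  ultimately have "g p \<noteq> 1" using assms(3) by simp
  then show "p dvd r" using assms(4) p by blast
qed (use assms in simp)

section \<open>Sums over pairs\<close>

definition coprime_weight :: "nat \<Rightarrow> nat \<Rightarrow> real" where
  "coprime_weight r n = (if coprime n r then 1 / real (divisor_count n) else 0)"

lemma divisor_count_coprime_mult:
  assumes "a > 0" "b > 0" "coprime a b"
  shows "divisor_count (a * b) = divisor_count a * divisor_count b"
  using sum_divisors_coprime_mult[of a b "\<lambda>_. 1::nat"] assms by (simp add: divisor_count_def)

lemma divisor_count_prime: "prime p \<Longrightarrow> divisor_count p = 2"
  using sum_divisors_prime_power[of p "\<lambda>_. 1::nat" 1] by (simp add: divisor_count_def)

lemma divisor_count_1: "divisor_count (Suc 0) = 1"
  by (simp add: divisor_count_def)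

lemma multiplicative_coprime_weight: "multiplicative (coprime_weight r)"
  by (auto simp: multiplicative_def coprime_weight_def divisor_count_coprime_mult divisor_count_1)

lemma dconv_prime: "prime p \<Longrightarrow> dconv u v p = u (Suc 0) * v p + u p * v (Suc 0)"
  using sum_divisors_prime_power[of p "\<lambda>d. u d * v (p div d)" 1]
  by (simp add: dconv_def prime_gt_0_nat)

text \<open>Since the divisor function is submultiplicative, each of the \<open>divisor_count n\<close> terms is at most
  \<open>1 / divisor_count n\<close>.\<close>
lemma dconv_coprime_weight_bounds:
  assumes "n > 0"
  shows "0 \<le> dconv (coprime_weight r) (coprime_weight s) n"
    and "dconv (coprime_weight r) (coprime_weight s) n \<le> 1"
proof -
  show "0 \<le> dconv (coprime_weight r) (coprime_weight s) n"
    unfolding dconv_def by (intro sum_nonneg) (simp add: coprime_weight_def)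
  have "dconv (coprime_weight r) (coprime_weight s) n \<le> (\<Sum>d | d dvd n. 1 / real (divisor_count n))"
    unfolding dconv_def
  proof (rule sum_mono)
    fix d assume "d \<in> {d. d dvd n}"
    then have d: "d dvd n" by simp
    then have pos: "d > 0" "n div d > 0"
      using assms by (auto intro: Nat.gr0I simp: dvd_div_eq_0_iff)
    have "divisor_count n \<le> divisor_count d * divisor_count (n div d)"
      using divisor_count_mult_le[OF pos] d by simp
    then have "real (divisor_count n) \<le> real (divisor_count d) * real (divisor_count (n div d))"
      by (metis of_nat_le_iff of_nat_mult)
    then have "1 / (real (divisor_count d) * real (divisor_count (n div d))) \<le> 1 / real (divisor_count n)"
      using divisor_count_pos[OF assms] by (intro divide_left_mono) auto
    moreover have "coprime_weight r d * coprime_weight s (n div d)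
        \<le> 1 / (real (divisor_count d) * real (divisor_count (n div d)))"
      by (simp add: coprime_weight_def)
    ultimately show "coprime_weight r d * coprime_weight s (n div d) \<le> 1 / real (divisor_count n)"
      by linarith
  qed
  also have "\<dots> = 1"
    using divisor_count_pos[OF assms] by (simp add: divisor_count_def)
  finally show "dconv (coprime_weight r) (coprime_weight s) n \<le> 1" .
qed

text \<open>The total contribution of the pairs with product \<open>n\<close> to the sum over pairs. The condition that both
  entries be odd is already enforced by the characters.\<close>
definition twisted_pair :: "(nat \<Rightarrow> real) \<Rightarrow> (nat \<Rightarrow> real) \<Rightarrow> nat \<Rightarrow> nat \<Rightarrow> nat \<Rightarrow> real" where
  "twisted_pair \<psi> \<phi> r s = dconv (\<lambda>n. \<psi> n * coprime_weight r n) (\<lambda>n. \<phi> n * coprime_weight s n)"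

lemma abs_twisted_pair_le_1:
  assumes "real_char8 \<psi>" "real_char8 \<phi>" "n > 0"
  shows "\<bar>twisted_pair \<psi> \<phi> r s n\<bar> \<le> 1"
proof -
  have "\<bar>twisted_pair \<psi> \<phi> r s n\<bar> \<le> dconv (coprime_weight r) (coprime_weight s) n"
    unfolding twisted_pair_def dconv_def
  proof (rule order_trans[OF sum_abs], rule sum_mono)
    fix d
    have w: "coprime_weight r d \<ge> 0" "coprime_weight s (n div d) \<ge> 0"
      by (simp_all add: coprime_weight_def)
    have "\<bar>\<psi> d\<bar> * \<bar>\<phi> (n div d)\<bar> \<le> 1"
      using assms by (intro mult_le_one real_char8_abs_le) auto
    then have "(\<bar>\<psi> d\<bar> * \<bar>\<phi> (n div d)\<bar>) * (coprime_weight r d * coprime_weight s (n div d))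
        \<le> 1 * (coprime_weight r d * coprime_weight s (n div d))"
      using w by (intro mult_right_mono) auto
    then show "\<bar>\<psi> d * coprime_weight r d * (\<phi> (n div d) * coprime_weight s (n div d))\<bar>
        \<le> coprime_weight r d * coprime_weight s (n div d)"
      using w by (simp add: abs_mult mult_ac)
  qed
  then show ?thesis using dconv_coprime_weight_bounds(2)[OF assms(3), of r s] by linarith
qed

text \<open>At a prime \<open>p\<close> not dividing \<open>r * s\<close> the value is \<open>(\<psi> p + \<phi> p) / 2\<close>, which vanishes when the
  two characters have opposite signs at \<open>p\<close>.\<close>
lemma simple_primes_if_twisted_pair_nonzero:
  assumes \<psi>: "real_char8 \<psi>" and \<phi>: "real_char8 \<phi>" and "n > 0"
    and nz: "twisted_pair \<psi> \<phi> r s n \<noteq> 0"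
  shows "simple_primes (r * s) (\<lambda>p. \<psi> p * \<phi> p = 1) n"
  unfolding simple_primes_def
proof (intro conjI allI impI)
  fix p assume p: "prime p" "p dvd n" "\<not> p ^ 2 dvd n"
  then obtain m where n: "n = p * m" by blast
  have "\<not> p dvd m" using p(3) by (simp add: n power2_eq_square)
  then have "coprime p m" using p(1) by (simp add: prime_imp_coprime)
  moreover have "p > 0" "m > 0" using n \<open>n > 0\<close> by auto
  moreover have "multiplicative (twisted_pair \<psi> \<phi> r s)"
    unfolding twisted_pair_def using \<psi> \<phi>
    by (intro multiplicative_dconv multiplicative_mult multiplicative_coprime_weight multiplicative_real_char8)
  ultimately have "twisted_pair \<psi> \<phi> r s p \<noteq> 0"
    using nz n by (auto simp: multiplicativeD)
  then have tp: "\<phi> p * coprime_weight s p + \<psi> p * coprime_weight r p \<noteq> 0"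
    using p(1) \<psi> \<phi> by (simp add: twisted_pair_def dconv_prime real_char8_one coprime_weight_def divisor_count_1)
  show "p dvd r * s \<or> \<psi> p * \<phi> p = 1"
  proof (cases "p dvd r * s")
    case False
    then have "coprime p r" "coprime p s"
      using p(1) by (simp_all add: prime_imp_coprime prime_dvd_mult_iff)
    then have "\<phi> p + \<psi> p \<noteq> 0"
      using tp p(1) by (auto simp: coprime_weight_def divisor_count_prime)
    then show ?thesis
      using real_char8_values[OF \<psi>, of p] real_char8_values[OF \<phi>, of p]
        real_char8_zero_iff[OF \<psi>, of p] real_char8_zero_iff[OF \<phi>, of p] by auto
  qed simp
qed (use assms in simp)

text \<open>For distinct characters no cancellation between different \<open>n\<close> is needed. The coefficients are at
  most 1 and live on numbers whose simple primes, apart from divisors of \<open>r * s\<close>, satisfy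
  \<open>\<psi> p * \<phi> p = 1\<close>. The product character is nonprincipal, so the logarithmic sum over these numbers
  is at most of order \<open>sqrt (ln N)\<close>, and they make up a proportion of order at most \<open>1 / sqrt (ln N)\<close> of all numbers.\<close>
lemma twisted_pair_sum_distinct:
  "\<exists>K>0. \<forall>\<psi> \<phi> r s N a. real_char8 \<psi> \<longrightarrow> real_char8 \<phi> \<longrightarrow> \<psi> a \<noteq> \<phi> a \<longrightarrow> r > 0 \<longrightarrow> s > 0 \<longrightarrow> N \<ge> 1 \<longrightarrow>
     \<bar>\<Sum>n=1..N. twisted_pair \<psi> \<phi> r s n\<bar>
       \<le> K * (real (divisor_count (r * s)) * (real N / sqrt (1 + ln (real N))))"
proof -
  obtain D where D: "D > 0"
      "\<forall>B. finite B \<longrightarrow> (\<forall>b\<in>B. squarefull b) \<longrightarrow> (\<Sum>b\<in>B. real b powr (-3/4)) \<le> D"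
    using bounded_sum_squarefull by blast
  obtain A where A: "A > 0" "\<forall>n. (\<Sum>q | prime_power q \<and> q \<le> n. ln (real q)) \<le> A * real n"
    using sum_ln_prime_powers_le by blast
  have "\<bar>\<Sum>n=1..N. twisted_pair \<psi> \<phi> r s n\<bar>
      \<le> (4 * (A + 2) * D) * (real (divisor_count (r * s)) * (real N / sqrt (1 + ln (real N))))"
    if \<psi>: "real_char8 \<psi>" and \<phi>: "real_char8 \<phi>" and a: "\<psi> a \<noteq> \<phi> a"
      and r: "r > 0" "s > 0" and N: "N \<ge> 1" for \<psi> \<phi> r s N a
  proof -
    let ?P = "\<lambda>p. \<psi> p * \<phi> p = 1"
    let ?S = "{n. simple_primes (r * s) ?P n \<and> n \<le> N}"
    define t where "t = real (divisor_count (r * s))"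
    define W where "W = (\<Sum>n\<in>?S. 1 / real n)"
    define L where "L = 1 + ln (real N)"
    have L: "L \<ge> 1" using N by (simp add: L_def)
    have chi: "real_char8 (\<lambda>n. \<psi> n * \<phi> n)" using \<psi> \<phi> by (rule real_char8_prod)
    \<comment> \<open>Both characters vanish exactly at the even numbers, so where they differ they are 1 and -1.\<close>
    have chia: "\<psi> a * \<phi> a = -1"
      using a real_char8_values[OF \<psi>, of a] real_char8_values[OF \<phi>, of a]
        real_char8_zero_iff[OF \<psi>, of a] real_char8_zero_iff[OF \<phi>, of a] by auto
    have Spos: "n > 0" if "n \<in> ?S" for n using that by (simp add: simple_primes_def)
    have "\<bar>\<Sum>n=1..N. twisted_pair \<psi> \<phi> r s n\<bar> \<le> (\<Sum>n=1..N. \<bar>twisted_pair \<psi> \<phi> r s n\<bar>)"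
      by (rule sum_abs)
    also have "\<dots> = (\<Sum>n\<in>?S. \<bar>twisted_pair \<psi> \<phi> r s n\<bar>)"
      using simple_primes_if_twisted_pair_nonzero[OF \<psi> \<phi>] Spos
      by (intro sum.mono_neutral_right) (auto simp: Suc_le_eq)
    also have "\<dots> \<le> (\<Sum>n\<in>?S. 1)"
      using Spos by (intro sum_mono abs_twisted_pair_le_1 \<psi> \<phi>) auto
    finally have sum_le: "\<bar>\<Sum>n=1..N. twisted_pair \<psi> \<phi> r s n\<bar> \<le> real (card ?S)" by simp
    have "real (card ?S) * ln (real N) \<le> (A + 1) * real N * W"
      unfolding W_def
    proof (rule card_mult_ln_le[OF A(2) less_imp_le[OF A(1)] _ _ N])
      show "n > 0" if "simple_primes (r * s) ?P n" for n
        using that by (simp add: simple_primes_def)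
      show "simple_primes (r * s) ?P m" if "coprime q m" "simple_primes (r * s) ?P (q * m)" for q m
        using that(2,1) by (rule simple_primes_unitary_divisor)
    qed
    \<comment> \<open>Together with the previous bound this also covers small N, where ln N gives no saving.\<close>
    moreover have "real (card ?S) \<le> real N * W"
    proof -
      have "(\<Sum>n\<in>?S. 1) \<le> (\<Sum>n\<in>?S. real N * (1 / real n))"
        by (intro sum_mono) (use Spos in \<open>auto simp: field_simps\<close>)
      then show ?thesis by (simp add: W_def sum_distrib_left)
    qed
    ultimately have cL: "real (card ?S) * L \<le> (A + 2) * real N * W"
      by (simp add: L_def algebra_simps)
    have "W = (\<Sum>n\<in>?S. real n powr (-1))"
      unfolding W_def using Spos by (intro sum.cong) (auto simp: powr_minus_divide)
    also have "\<dots> \<le> t * D * (\<Sum>m | all_primes ?P m \<and> m \<le> N. real m powr (-1))"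
      unfolding t_def using r by (intro sum_simple_primes_le D) auto
    also have "(\<Sum>m | all_primes ?P m \<and> m \<le> N. real m powr (-1)) = (\<Sum>m | all_primes ?P m \<and> m \<le> N. 1 / real m)"
      by (intro sum.cong) (auto simp: powr_minus_divide all_primes_def)
    also have "t * D * \<dots> \<le> t * D * sqrt (16 * L)"
      unfolding L_def t_def using D chia
      by (intro mult_left_mono sum_all_primes_char_le[OF chi _ N]) auto
    finally have "W \<le> t * D * (4 * sqrt L)" by (simp add: real_sqrt_mult)
    then have "(A + 2) * real N * W \<le> (A + 2) * real N * (t * D * (4 * sqrt L))"
      using A by (intro mult_left_mono) auto
    then have "real (card ?S) * (sqrt L * sqrt L) \<le> (A + 2) * real N * (t * D * (4 * sqrt L))"
      using cL L by simp
    then have "(real (card ?S) * sqrt L) * sqrt L \<le> ((A + 2) * real N * (t * D * 4)) * sqrt L"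
      by (simp only: mult_ac)
    then have "real (card ?S) * sqrt L \<le> (A + 2) * real N * (t * D * 4)"
      using L by (simp add: mult_le_cancel_right)
    then have "real (card ?S) \<le> (4 * (A + 2) * D) * (t * (real N / sqrt L))"
      using L by (simp add: field_simps)
    then show ?thesis using sum_le by (simp add: t_def L_def)
  qed
  moreover have "4 * (A + 2) * D > 0" using A D by simp
  ultimately show ?thesis by blast
qed

text \<open>For equal characters the coefficient of \<open>n\<close> is \<open>\<psi> n * g n\<close>, where \<open>g p = 1\<close> for every prime
  \<open>p\<close> not dividing \<open>r * s\<close>, so its support is not thin and cancellation in \<open>\<psi>\<close> is needed. Writing \<open>g\<close> as
  the divisor sum of \<open>h\<close>, the sums of \<open>\<psi>\<close> over the complementary divisors are bounded, and \<open>h\<close> is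
  bounded and lives on squarefull numbers times divisors of \<open>r * s\<close>. This saves a factor
  \<open>N powr (1/4)\<close>.\<close>
lemma twisted_pair_sum_equal:
  "\<exists>K>0. \<forall>\<psi> r s N a. real_char8 \<psi> \<longrightarrow> \<psi> a = -1 \<longrightarrow> r > 0 \<longrightarrow> s > 0 \<longrightarrow> N \<ge> 1 \<longrightarrow>
     \<bar>\<Sum>n=1..N. twisted_pair \<psi> \<psi> r s n\<bar>
       \<le> K * (real (divisor_count (r * s)) * (real N / sqrt (1 + ln (real N))))"
proof -
  obtain D where D: "D > 0"
      "\<forall>B. finite B \<longrightarrow> (\<forall>b\<in>B. squarefull b) \<longrightarrow> (\<Sum>b\<in>B. real b powr (-3/4)) \<le> D"
    using bounded_sum_squarefull by blast
  have "\<bar>\<Sum>n=1..N. twisted_pair \<psi> \<psi> r s n\<bar>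
      \<le> (16 * D) * (real (divisor_count (r * s)) * (real N / sqrt (1 + ln (real N))))"
    if \<psi>: "real_char8 \<psi>" and a: "\<psi> a = -1" and r: "r > 0" "s > 0" and N: "N \<ge> 1" for \<psi> r s N a
  proof -
    let ?S = "{n. simple_primes (r * s) (\<lambda>_. False) n \<and> n \<le> N}"
    define t where "t = real (divisor_count (r * s))"
    define g where "g = dconv (coprime_weight r) (coprime_weight s)"
    define h where "h = prime_power_difference g"
    have g: "multiplicative g"
      unfolding g_def by (intro multiplicative_dconv multiplicative_coprime_weight)
    have g01: "0 \<le> g n \<and> g n \<le> 1" if "n > 0" for n
      unfolding g_def using dconv_coprime_weight_bounds that by blast
    have gp: "g p = 1" if "prime p" "\<not> p dvd r * s" for p
    proof -
      have "coprime p r" "coprime p s" using that by (simp_all add: prime_imp_coprime prime_dvd_mult_iff)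
      then show ?thesis
        using that(1) by (simp add: g_def dconv_prime coprime_weight_def divisor_count_prime divisor_count_1)
    qed
    have Spos: "n > 0" if "n \<in> ?S" for n using that by (simp add: simple_primes_def)
    have "(\<Sum>n=1..N. twisted_pair \<psi> \<psi> r s n) = (\<Sum>n=1..N. \<Sum>d | d dvd n. h d * \<psi> d * \<psi> (n div d))"
    proof (rule sum.cong[OF refl])
      fix n assume "n \<in> {1..N}"
      then have n: "n > 0" by simp
      have split: "\<psi> d * \<psi> (n div d) = \<psi> n" if "d dvd n" for d
        using that real_char8_mult[OF \<psi>, of d "n div d"] by simp
      have "twisted_pair \<psi> \<psi> r s n = \<psi> n * g n"
        unfolding twisted_pair_def g_def dconv_def sum_distrib_left
        by (intro sum.cong refl) (simp add: split[symmetric] mult_ac)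
      also have "\<dots> = (\<Sum>d | d dvd n. \<psi> n * h d)"
        unfolding h_def sum_distrib_left[symmetric] using g n
        by (simp add: sum_divisors_prime_power_difference)
      also have "\<dots> = (\<Sum>d | d dvd n. h d * \<psi> d * \<psi> (n div d))"
        by (intro sum.cong refl) (simp add: split[symmetric] mult_ac)
      finally show "twisted_pair \<psi> \<psi> r s n = \<dots>" .
    qed
    also have "\<dots> = (\<Sum>d=1..N. \<Sum>m=1..N div d. h d * \<psi> d * \<psi> m)"
      by (rule sum_divisors_swap)
    finally have rearranged: "(\<Sum>n=1..N. twisted_pair \<psi> \<psi> r s n)
        = (\<Sum>d=1..N. \<Sum>m=1..N div d. h d * \<psi> d * \<psi> m)" .
    have "\<bar>\<Sum>n=1..N. twisted_pair \<psi> \<psi> r s n\<bar> \<le> (\<Sum>d=1..N. \<bar>h d\<bar> * 8)"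
      unfolding rearranged
    proof (rule order_trans[OF sum_abs], rule sum_mono)
      fix d
      have "\<bar>\<psi> d\<bar> * \<bar>\<Sum>m=1..N div d. \<psi> m\<bar> \<le> 1 * 8"
        using real_char8_abs_le[OF \<psi>] real_char8_partial_sum_bound[OF \<psi> a] by (intro mult_mono) auto
      then have "\<bar>h d\<bar> * (\<bar>\<psi> d\<bar> * \<bar>\<Sum>m=1..N div d. \<psi> m\<bar>) \<le> \<bar>h d\<bar> * 8"
        by (intro mult_left_mono) auto
      then show "\<bar>\<Sum>m=1..N div d. h d * \<psi> d * \<psi> m\<bar> \<le> \<bar>h d\<bar> * 8"
        by (simp add: sum_distrib_left[symmetric] abs_mult mult.assoc)
    qed
    also have "\<dots> = (\<Sum>d\<in>?S. \<bar>h d\<bar> * 8)"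
      using simple_primes_if_prime_power_difference_nonzero[of g _ "r * s"] gp g Spos
      by (intro sum.mono_neutral_right) (auto simp: Suc_le_eq h_def multiplicative_def)
    \<comment> \<open>Rankin's trick: count with the weight (N / d) powr (3/4), which is at least 1.\<close>
    also have "\<dots> \<le> (\<Sum>d\<in>?S. 8 * (real N powr (3/4) * real d powr (-3/4)))"
    proof (rule sum_mono)
      fix d assume d: "d \<in> ?S"
      have "1 = real d powr (3/4) * real d powr (-3/4)"
        using Spos[OF d] by (simp add: powr_add[symmetric])
      also have "\<dots> \<le> real N powr (3/4) * real d powr (-3/4)"
        using d by (intro mult_right_mono powr_mono2) auto
      finally have "1 \<le> real N powr (3/4) * real d powr (-3/4)" .
      moreover have "\<bar>h d\<bar> \<le> 1"
        unfolding h_def using g01 by (rule abs_prime_power_difference_le)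
      ultimately show "\<bar>h d\<bar> * 8 \<le> 8 * (real N powr (3/4) * real d powr (-3/4))" by linarith
    qed
    also have "\<dots> = 8 * (real N powr (3/4) * (\<Sum>d\<in>?S. real d powr (-(3/4))))"
      by (simp add: sum_distrib_left)
    finally have by_exponents: "\<bar>\<Sum>n=1..N. twisted_pair \<psi> \<psi> r s n\<bar>
        \<le> 8 * (real N powr (3/4) * (\<Sum>d\<in>?S. real d powr (-(3/4))))" .
    have "{m. all_primes (\<lambda>_. False) m \<and> m \<le> N} = {1}"
      using N prime_factor_nat by (auto simp: all_primes_def)
    moreover have "(\<Sum>d\<in>?S. real d powr (-(3/4)))
        \<le> t * D * (\<Sum>m | all_primes (\<lambda>_. False) m \<and> m \<le> N. real m powr (-(3/4)))"
      unfolding t_def using r by (intro sum_simple_primes_le D) auto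
    ultimately have "(\<Sum>d\<in>?S. real d powr (-(3/4))) \<le> t * D" by simp
    then have "8 * (real N powr (3/4) * (\<Sum>d\<in>?S. real d powr (-(3/4)))) \<le> 8 * (real N powr (3/4) * (t * D))"
      by (intro mult_left_mono) auto
    with by_exponents have "\<bar>\<Sum>n=1..N. twisted_pair \<psi> \<psi> r s n\<bar> \<le> 8 * (real N powr (3/4) * (t * D))"
      by linarith
    moreover have "real N powr (3/4) \<le> 2 * (real N / sqrt (1 + ln (real N)))"
    proof -
      define q where "q = real N powr (1/2)"
      have q: "q > 0" "ln (real N) = 2 * ln q" using N by (simp_all add: q_def ln_powr)
      have "1 + ln (real N) \<le> 4 * q" using ln_le_minus_one[OF q(1)] q by linarith
      also have "\<dots> = 4 * real N powr (1/2)" by (simp add: q_def)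
      also have "\<dots> = (2 * real N powr (1/4))\<^sup>2"
        by (simp add: power_mult_distrib power2_eq_square powr_add[symmetric])
      finally have "sqrt (1 + ln (real N)) \<le> 2 * real N powr (1/4)"
        by (rule real_le_lsqrt[rotated 1]) (use N in auto)
      then have "real N powr (3/4) * sqrt (1 + ln (real N)) \<le> real N powr (3/4) * (2 * real N powr (1/4))"
        by (intro mult_left_mono) auto
      also have "\<dots> = 2 * real N" using N by (simp add: powr_add[symmetric])
      finally have *: "real N powr (3/4) * sqrt (1 + ln (real N)) \<le> 2 * real N" .
      have "sqrt (1 + ln (real N)) > 0" using N by (simp add: add_pos_nonneg)
      then show ?thesis using * by (simp add: field_simps)
    qed
    then have "8 * (real N powr (3/4) * (t * D)) \<le> 8 * (2 * (real N / sqrt (1 + ln (real N))) * (t * D))"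
      using D(1) by (intro mult_left_mono mult_right_mono) (auto simp: t_def)
    ultimately show ?thesis by (simp add: t_def mult_ac)
  qed
  moreover have "16 * D > 0" using D by simp
  ultimately show ?thesis by blast
qed

definition pair_range :: "real \<Rightarrow> nat \<Rightarrow> nat \<Rightarrow> (nat \<times> nat) set" where
  "pair_range Y r s = {(a, b). a \<ge> 1 \<and> b \<ge> 1 \<and> real (a * b) \<le> Y \<and> gcd a (2 * r) = 1 \<and> gcd b (2 * s) = 1}"

definition pair_term :: "(nat \<Rightarrow> real) \<Rightarrow> (nat \<Rightarrow> real) \<Rightarrow> nat \<times> nat \<Rightarrow> real" where
  "pair_term \<psi> \<phi> = (\<lambda>(a, b). \<psi> a * \<phi> b / real (divisor_count a * divisor_count b))"

lemma sum_pair_range: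
  assumes \<psi>: "real_char8 \<psi>" and \<phi>: "real_char8 \<phi>" and Y: "Y \<ge> 0"
  shows "(\<Sum>w\<in>pair_range Y r s. pair_term \<psi> \<phi> w) = (\<Sum>n=1..nat \<lfloor>Y\<rfloor>. twisted_pair \<psi> \<phi> r s n)"
proof -
  define N where "N = nat \<lfloor>Y\<rfloor>"
  let ?u = "\<lambda>n. \<psi> n * coprime_weight r n" and ?v = "\<lambda>n. \<phi> n * coprime_weight s n"
  have N: "real k \<le> Y \<longleftrightarrow> k \<le> N" for k
    using Y by (simp add: N_def le_nat_iff le_floor_iff)
  have cop: "gcd k (2 * q) = 1 \<longleftrightarrow> odd k \<and> coprime k q" for k q :: nat
    by (simp only: coprime_iff_gcd_eq_1[symmetric] coprime_mult_right_iff coprime_right_2_iff_odd)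
  have range: "real (a * b) \<le> Y \<longleftrightarrow> b \<le> N div a" if "a \<ge> 1" for a b
    using that by (simp only: N) (simp add: less_eq_div_iff_mult_less_eq mult.commute)
  have "(\<Sum>n=1..N. twisted_pair \<psi> \<phi> r s n) = (\<Sum>a=1..N. \<Sum>b=1..N div a. ?u a * ?v b)"
    unfolding twisted_pair_def dconv_def by (rule sum_divisors_swap)
  also have "\<dots> = (\<Sum>(a, b)\<in>(SIGMA a:{1..N}. {1..N div a}). ?u a * ?v b)"
    by (rule sum.Sigma) auto
  also have "\<dots> = (\<Sum>(a, b)\<in>pair_range Y r s. ?u a * ?v b)"
  proof (rule sum.mono_neutral_right)
    show "pair_range Y r s \<subseteq> (SIGMA a:{1..N}. {1..N div a})"
    proof (clarsimp simp: pair_range_def)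
      fix a b :: nat assume ab: "Suc 0 \<le> a" "Suc 0 \<le> b" "real a * real b \<le> Y"
      then have "a * b \<le> N" using N[of "a * b"] by simp
      moreover have "a \<le> a * b" using ab by simp
      moreover have "b \<le> N div a" using range[of a b] ab by simp
      ultimately show "a \<le> N \<and> b \<le> N div a" by linarith
    qed
    show "\<forall>w\<in>(SIGMA a:{1..N}. {1..N div a}) - pair_range Y r s. (case w of (a, b) \<Rightarrow> ?u a * ?v b) = 0"
    proof (rule ballI, clarify)
      fix a b assume ab: "a \<in> {1..N}" "b \<in> {1..N div a}" "(a, b) \<notin> pair_range Y r s"
      then have "\<not> (odd a \<and> coprime a r \<and> odd b \<and> coprime b s)"
        using range[of a b] by (auto simp: pair_range_def cop)
      then show "?u a * ?v b = 0"
        using real_char8_zero_iff[OF \<psi>, of a] real_char8_zero_iff[OF \<phi>, of b]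
        by (auto simp: coprime_weight_def)
    qed
  qed auto
  also have "\<dots> = (\<Sum>w\<in>pair_range Y r s. pair_term \<psi> \<phi> w)"
    by (intro sum.cong) (auto simp: pair_range_def cop[unfolded One_nat_def] pair_term_def coprime_weight_def)
  finally show ?thesis by (simp add: N_def)
qed

text \<open>If the characters agree, both are nonprincipal, and if they differ, their product is; these are the
  two cases above. The summand 1 next to \<open>ln Y\<close> keeps the bound meaningful down to \<open>Y = 1\<close>.\<close>
lemma pair_sum_bound:
  "\<exists>K>0. \<forall>\<psi> \<phi> r s Y. real_char8 \<psi> \<longrightarrow> real_char8 \<phi> \<longrightarrow> (\<exists>a. \<psi> a = -1 \<or> \<phi> a = -1) \<longrightarrow>
     r > 0 \<longrightarrow> s > 0 \<longrightarrow> Y \<ge> 1 \<longrightarrow>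
     \<bar>\<Sum>w\<in>pair_range Y r s. pair_term \<psi> \<phi> w\<bar>
       \<le> K * (real (divisor_count r * divisor_count s) * Y / sqrt (1 + ln Y))"
proof -
  obtain K1 where K1: "K1 > 0"
    "\<And>\<psi> \<phi> r s N a. real_char8 \<psi> \<Longrightarrow> real_char8 \<phi> \<Longrightarrow> \<psi> a \<noteq> \<phi> a \<Longrightarrow> r > 0 \<Longrightarrow> s > 0 \<Longrightarrow> N \<ge> 1 \<Longrightarrow>
     \<bar>\<Sum>n=1..N. twisted_pair \<psi> \<phi> r s n\<bar>
       \<le> K1 * (real (divisor_count (r * s)) * (real N / sqrt (1 + ln (real N))))"
    using twisted_pair_sum_distinct by blast
  obtain K2 where K2: "K2 > 0"
    "\<And>\<psi> r s N a. real_char8 \<psi> \<Longrightarrow> \<psi> a = -1 \<Longrightarrow> r > 0 \<Longrightarrow> s > 0 \<Longrightarrow> N \<ge> 1 \<Longrightarrow>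
     \<bar>\<Sum>n=1..N. twisted_pair \<psi> \<psi> r s n\<bar>
       \<le> K2 * (real (divisor_count (r * s)) * (real N / sqrt (1 + ln (real N))))"
    using twisted_pair_sum_equal by blast
  let ?K = "2 * (K1 + K2)"
  have "\<bar>\<Sum>w\<in>pair_range Y r s. pair_term \<psi> \<phi> w\<bar>
       \<le> ?K * (real (divisor_count r * divisor_count s) * Y / sqrt (1 + ln Y))"
    if \<psi>: "real_char8 \<psi>" and \<phi>: "real_char8 \<phi>" and a: "\<psi> a = -1 \<or> \<phi> a = -1"
      and r: "r > 0" "s > 0" and Y: "Y \<ge> 1" for \<psi> \<phi> r s Y a
  proof -
    define N where "N = nat \<lfloor>Y\<rfloor>"
    define B where "B = real (divisor_count (r * s)) * (real N / sqrt (1 + ln (real N)))"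
    have N: "N \<ge> 1" "real N \<le> Y" "Y \<le> 2 * real N"
    proof -
      have "real N = real_of_int \<lfloor>Y\<rfloor>" "1 \<le> real_of_int \<lfloor>Y\<rfloor>" using Y by (simp_all add: N_def)
      then show "N \<ge> 1" "real N \<le> Y" "Y \<le> 2 * real N" by linarith+
    qed
    have B0: "B \<ge> 0" using N by (simp add: B_def)
    have "\<bar>\<Sum>n=1..N. twisted_pair \<psi> \<phi> r s n\<bar> \<le> (K1 + K2) * B"
    proof (cases "\<psi> = \<phi>")
      case True
      then have "\<bar>\<Sum>n=1..N. twisted_pair \<psi> \<phi> r s n\<bar> \<le> K2 * B"
        using K2(2)[OF \<psi> _ r N(1)] a by (auto simp: B_def)
      also have "\<dots> \<le> (K1 + K2) * B" using K1(1) B0 by (intro mult_right_mono) auto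
      finally show ?thesis .
    next
      case False
      then obtain b where "\<psi> b \<noteq> \<phi> b" by blast
      then have "\<bar>\<Sum>n=1..N. twisted_pair \<psi> \<phi> r s n\<bar> \<le> K1 * B"
        using K1(2)[OF \<psi> \<phi> _ r N(1)] by (simp add: B_def)
      also have "\<dots> \<le> (K1 + K2) * B" using K2(1) B0 by (intro mult_right_mono) auto
      finally show ?thesis .
    qed
    \<comment> \<open>Replacing Y by its integer part N costs a factor of at most 2, since Y \<le> 2 * N.\<close>
    moreover have "B \<le> real (divisor_count r * divisor_count s) * (2 * (Y / sqrt (1 + ln Y)))"
      unfolding B_def
    proof (intro mult_mono)
      show "real (divisor_count (r * s)) \<le> real (divisor_count r * divisor_count s)"
        using divisor_count_mult_le[OF r] by (simp only: of_nat_le_iff)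
      have lnN: "ln (real N) \<ge> 0" using N by simp
      have "ln Y \<le> ln (2 * real N)" using Y N by simp
      also have "\<dots> = ln 2 + ln (real N)" using N by (simp add: ln_mult)
      also have "\<dots> \<le> 1 + ln (real N)" using ln_2_less_1 by simp
      finally have "1 + ln Y \<le> 2\<^sup>2 * (1 + ln (real N))" using lnN by simp
      then have "sqrt (1 + ln Y) \<le> sqrt (2\<^sup>2 * (1 + ln (real N)))" by (rule real_sqrt_le_mono)
      also have "\<dots> = 2 * sqrt (1 + ln (real N))" by (subst real_sqrt_mult) (simp only: real_sqrt_abs abs_numeral)
      finally have s: "sqrt (1 + ln Y) \<le> 2 * sqrt (1 + ln (real N))" .
      have pos: "sqrt (1 + ln Y) > 0" "sqrt (1 + ln (real N)) > 0"
        using Y lnN by (simp_all add: add_pos_nonneg)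
      have "real N * sqrt (1 + ln Y) \<le> Y * (2 * sqrt (1 + ln (real N)))"
        using N s Y pos by (intro mult_mono) auto
      then show "real N / sqrt (1 + ln (real N)) \<le> 2 * (Y / sqrt (1 + ln Y))"
        using pos by (simp add: field_simps)
    qed (use N in auto)
    then have "(K1 + K2) * B
        \<le> (K1 + K2) * (real (divisor_count r * divisor_count s) * (2 * (Y / sqrt (1 + ln Y))))"
      using K1(1) K2(1) by (intro mult_left_mono) auto
    moreover have "(K1 + K2) * (d * (2 * (Y / q))) = ?K * (d * Y / q)" for d q :: real
      by (simp add: algebra_simps add_divide_distrib)
    ultimately have "\<bar>\<Sum>n=1..N. twisted_pair \<psi> \<phi> r s n\<bar>
        \<le> ?K * (real (divisor_count r * divisor_count s) * Y / sqrt (1 + ln Y))"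
      by (metis order_trans)
    then show ?thesis
      using sum_pair_range[OF \<psi> \<phi>, of Y r s] Y by (simp only: N_def)
  qed
  moreover have "?K > 0" using K1 K2 by simp
  ultimately show ?thesis by blast
qed

section \<open>Dirichlet characters modulo 8 are real\<close>

lemma dirichlet_character_8_one:
  assumes "dirichlet_character 8 \<chi>"
  shows "\<chi> 1 = 1"
proof -
  have "\<chi> (1 * 1) = \<chi> 1 * \<chi> 1" "\<chi> 1 \<noteq> 0"
    using assms by (auto simp: dirichlet_character_def simp del: mult_1 mult_1_right)
  then show ?thesis by simp
qed

lemma dirichlet_character_8_mod:
  assumes "dirichlet_character 8 \<chi>"
  shows "\<chi> (n mod 8) = \<chi> n"
proof -
  have per: "\<chi> (a + 8) = \<chi> a" for a using assms by (simp add: dirichlet_character_def)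
  have nat: "\<chi> (a + 8 * int k) = \<chi> a" for a k
  proof (induction k)
    case (Suc k)
    have "a + 8 * int (Suc k) = (a + 8 * int k) + 8" by simp
    then show ?case using per Suc by metis
  qed simp
  show ?thesis
  proof (cases "n div 8 \<ge> 0")
    case True
    then show ?thesis using nat[of "n mod 8" "nat (n div 8)"] by simp
  next
    case False
    then show ?thesis using nat[of n "nat (- (n div 8))"] by (simp add: minus_mult_div_eq_mod)
  qed
qed

lemma coprime_8_iff_odd: "coprime (a::int) 8 \<longleftrightarrow> odd a"
proof -
  have "coprime a (2 ^ 3) \<longleftrightarrow> odd a" by (subst coprime_power_right_iff) simp
  then show ?thesis by simp
qed

lemma dirichlet_character_8_real:
  assumes "dirichlet_character 8 \<chi>"
  obtains \<psi> where "real_char8 \<psi>" "\<And>n. \<chi> (int n) = of_real (\<psi> n)"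
    "\<chi> \<noteq> principal_character 8 \<Longrightarrow> \<exists>a. \<psi> a = -1"
proof -
  have mult: "\<chi> (a * b) = \<chi> a * \<chi> b" and per: "\<chi> (a + 8) = \<chi> a"
    and zero: "\<chi> a = 0 \<longleftrightarrow> even a" for a b
    using assms by (auto simp: dirichlet_character_def coprime_8_iff_odd)
  have odd_values: "\<chi> a = 1 \<or> \<chi> a = -1" if "odd a" for a
  proof -
    have "a mod 8 = 1 \<or> a mod 8 = 3 \<or> a mod 8 = 5 \<or> a mod 8 = 7" using that by presburger
    then have "(a * a) mod 8 = 1"
      by (elim disjE) (simp_all add: mod_mult_eq[of a 8 a, symmetric])
    then have "\<chi> (a * a) = 1"
      using dirichlet_character_8_mod[OF assms, of "a * a"] dirichlet_character_8_one[OF assms] by simp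
    then show ?thesis by (simp add: mult square_eq_1_iff)
  qed
  define \<psi> where "\<psi> n = Re (\<chi> (int n))" for n
  have eq: "\<chi> (int n) = of_real (\<psi> n)" for n
    using odd_values[of "int n"] zero[of "int n"] by (cases "even n") (auto simp: \<psi>_def)
  have "real_char8 \<psi>"
    unfolding real_char8_def
  proof (intro conjI allI)
    fix a b :: nat
    have "of_real (\<psi> (a * b)) = (of_real (\<psi> a * \<psi> b) :: complex)"
      by (simp add: eq[symmetric] mult)
    then show "\<psi> (a * b) = \<psi> a * \<psi> b" by (simp only: of_real_eq_iff)
  next
    fix n show "\<psi> (n + 8) = \<psi> n" by (simp add: \<psi>_def per)
  next
    fix n
    have "(of_real (\<psi> n) :: complex) = 0 \<longleftrightarrow> even n" by (simp add: eq[symmetric] zero)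
    then show "\<psi> n = 0 \<longleftrightarrow> even n" by simp
  qed
  moreover have "\<exists>a. \<psi> a = -1" if nonprincipal: "\<chi> \<noteq> principal_character 8"
  proof -
    obtain a where "\<chi> a \<noteq> principal_character 8 a" using nonprincipal by (auto simp: fun_eq_iff)
    then have "odd a \<and> \<chi> a \<noteq> 1"
      using zero[of a] by (auto simp: principal_character_def coprime_8_iff_odd split: if_splits)
    then have "\<chi> a = -1" using odd_values by blast
    moreover have "int (nat (a mod 8)) = a mod 8" by simp
    ultimately have "\<chi> (int (nat (a mod 8))) = -1"
      using dirichlet_character_8_mod[OF assms, of a] by simp
    then show ?thesis by (intro exI[of _ "nat (a mod 8)"]) (simp add: \<psi>_def)
  qed
  ultimately show ?thesis using that eq by blast
qed

section \<open>The fourfold sum\<close>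

text \<open>As \<open>ln (c * M) \<le> 2 * C * ln (ln X)\<close>, which is at most \<open>ln X / 2\<close> up to a constant, dividing \<open>X\<close> by
  \<open>c * M\<close> changes its logarithm only by a bounded factor.\<close>
lemma ln_le_ln_quotient:
  fixes C :: real
  assumes "C > 0"
  shows "\<exists>K>0. \<forall>X c M. X \<ge> 3 \<longrightarrow> 1 \<le> c \<longrightarrow> c \<le> ln X powr C \<longrightarrow> 1 \<le> M \<longrightarrow> M \<le> ln X powr C \<longrightarrow>
           1 \<le> X / (c * M) \<longrightarrow> ln X \<le> K * (1 + ln (X / (c * M)))"
proof -
  let ?K = "2 + 4 * C * \<bar>ln (4 * C)\<bar>"
  have "ln X \<le> ?K * (1 + ln (X / (c * M)))"
    if X: "X \<ge> 3" and c: "1 \<le> c" "c \<le> ln X powr C" and M: "1 \<le> M" "M \<le> ln X powr C"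
      and Y: "1 \<le> X / (c * M)" for X c M :: real
  proof -
    define t where "t = ln X"
    have t: "t > 0" using X by (simp add: t_def)
    have lnle: "ln z \<le> C * ln t" if "1 \<le> z" "z \<le> ln X powr C" for z
    proof -
      have "ln z \<le> ln (t powr C)" using that by (subst ln_le_cancel_iff) (auto simp: t_def)
      then show ?thesis using t by (simp add: ln_powr)
    qed
    \<comment> \<open>The scale 4 * C makes 2 * C * ln t cost at most half of t.\<close>
    have "ln t = ln (t / (4 * C)) + ln (4 * C)" using t assms by (simp add: ln_div)
    also have "\<dots> \<le> t / (4 * C) + \<bar>ln (4 * C)\<bar>"
      using ln_le_minus_one[of "t / (4 * C)"] t assms by auto
    finally have "2 * C * ln t \<le> 2 * C * (t / (4 * C) + \<bar>ln (4 * C)\<bar>)"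
      using assms by (intro mult_left_mono) auto
    also have "\<dots> = t / 2 + 2 * C * \<bar>ln (4 * C)\<bar>" using assms by (simp add: field_simps)
    finally have small: "2 * C * ln t \<le> t / 2 + 2 * C * \<bar>ln (4 * C)\<bar>" .
    define y where "y = ln (X / (c * M))"
    have "y = t - (ln c + ln M)"
      using X c M by (simp add: y_def t_def ln_div ln_mult)
    then have "t \<le> 2 * y + 4 * C * \<bar>ln (4 * C)\<bar>"
      using lnle[OF c] lnle[OF M] small by simp
    moreover have "y \<ge> 0" using Y by (simp add: y_def)
    then have "2 * y + 4 * C * \<bar>ln (4 * C)\<bar> \<le> ?K * (1 + y)"
      using assms by (simp add: algebra_simps)
    ultimately show ?thesis by (simp add: t_def y_def)
  qed
  moreover have "?K > 0" using assms by (intro add_pos_nonneg) auto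
  ultimately show ?thesis by blast
qed

text \<open>The maximum norm is bounded exactly when both entries are, so the range of summation is a product
  of two ranges of pairs.\<close>
lemma sum_summation_range_factors:
  fixes X :: real
  assumes "c01 \<ge> 1" "c23 \<ge> 1" "M \<ge> 1"
  shows "(\<Sum>(n0, n1, n2, n3)\<in>summation_range X r c01 c23 M. f (n0, n1) * g (n2, n3))
       = (\<Sum>w\<in>pair_range (X / (real c01 * real M)) (r 0) (r 1). f w) *
         (\<Sum>w\<in>pair_range (X / (real c23 * real M)) (r 2) (r 3). g w :: complex)"
proof -
  let ?A = "pair_range (X / (real c01 * real M)) (r 0) (r 1)"
  let ?B = "pair_range (X / (real c23 * real M)) (r 2) (r 3)"
  have norm: "max_norm (real p) (real q) * real M \<le> X \<longleftrightarrow> real p * real M \<le> X \<and> real q * real M \<le> X" for p q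
    by (simp add: max_norm_def max_mult_distrib_right)
  have quot: "real (p * c) * real M \<le> X \<longleftrightarrow> real p \<le> X / (real c * real M)" if "c \<ge> 1" for p c
    using that assms(3) by (simp add: pos_le_divide_eq mult.assoc)
  have mem: "(a, b, c, d) \<in> summation_range X r c01 c23 M \<longleftrightarrow> (a, b) \<in> ?A \<and> (c, d) \<in> ?B" for a b c d
    unfolding summation_range_def pair_range_def
    by (simp only: mem_Collect_eq prod.case norm quot[OF assms(1)] quot[OF assms(2)]) blast
  have "(\<Sum>(n0, n1, n2, n3)\<in>summation_range X r c01 c23 M. f (n0, n1) * g (n2, n3))
      = (\<Sum>(v, w)\<in>?A \<times> ?B. f v * g w)"
    by (rule sum.reindex_bij_witness[of _ "\<lambda>((a, b), (c, d)). (a, b, c, d)" "\<lambda>(a, b, c, d). ((a, b), (c, d))"])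
      (auto simp: mem)
  also have "\<dots> = (\<Sum>v\<in>?A. f v) * (\<Sum>w\<in>?B. g w)"
    by (simp add: sum_product sum.cartesian_product)
  finally show ?thesis .
qed

theorem lemma6p1:
  fixes C1 C2 :: real
  assumes "C1 > 0" and "C2 > 0"
  shows "\<exists>K>0. \<forall>X::real. \<forall>\<chi> :: nat \<Rightarrow> int \<Rightarrow> complex. \<forall>r :: nat \<Rightarrow> nat. \<forall>c01 c23 M :: nat.
     X \<ge> 3 \<longrightarrow>
     (\<forall>i\<in>{0,1,2,3}. dirichlet_character 8 (\<chi> i)) \<longrightarrow>
     (\<exists>i\<in>{0,1}. \<exists>j\<in>{2,3}. \<chi> i \<noteq> principal_character 8 \<and> \<chi> j \<noteq> principal_character 8) \<longrightarrow>
     (\<forall>i\<in>{0,1,2,3}. odd (r i) \<and> 1 \<le> r i \<and> real (r i) \<le> ln X powr C1) \<longrightarrow>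
     1 \<le> c01 \<longrightarrow> real c01 \<le> ln X powr C2 \<longrightarrow>
     1 \<le> c23 \<longrightarrow> real c23 \<le> ln X powr C2 \<longrightarrow>
     1 \<le> M \<longrightarrow> real M \<le> ln X powr C2 \<longrightarrow>
     cmod (\<Sum>(n0, n1, n2, n3)\<in>summation_range X r c01 c23 M.
             \<chi> 0 (int n0) * \<chi> 2 (int n2) * \<chi> 1 (int n1) * \<chi> 3 (int n3) /
             of_nat (divisor_count n0 * divisor_count n1 * divisor_count n2 * divisor_count n3))
       \<le> K * (real (divisor_count (r 0) * divisor_count (r 1) * divisor_count (r 2) * divisor_count (r 3)) * X^2
              / (real c01 * real c23 * (real M)^2 * ln X))"
proof -
  obtain K where K: "K > 0"
    "\<And>\<psi> \<phi> r s Y. real_char8 \<psi> \<Longrightarrow> real_char8 \<phi> \<Longrightarrow> (\<exists>a. \<psi> a = -1 \<or> \<phi> a = -1) \<Longrightarrow>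
     r > 0 \<Longrightarrow> s > 0 \<Longrightarrow> Y \<ge> 1 \<Longrightarrow>
     \<bar>\<Sum>w\<in>pair_range Y r s. pair_term \<psi> \<phi> w\<bar>
       \<le> K * (real (divisor_count r * divisor_count s) * Y / sqrt (1 + ln Y))"
    using pair_sum_bound by blast
  obtain L where L: "L > 0"
    "\<And>X c M. X \<ge> 3 \<Longrightarrow> 1 \<le> c \<Longrightarrow> c \<le> ln X powr C2 \<Longrightarrow> 1 \<le> M \<Longrightarrow> M \<le> ln X powr C2 \<Longrightarrow>
           1 \<le> X / (c * M) \<Longrightarrow> ln X \<le> L * (1 + ln (X / (c * M)))"
    using ln_le_ln_quotient[OF assms(2)] by blast
  show ?thesis
  proof (intro exI[of _ "K\<^sup>2 * L"] conjI allI impI)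
    show "K\<^sup>2 * L > 0" using K L by simp
    fix X :: real and \<chi> :: "nat \<Rightarrow> int \<Rightarrow> complex" and r :: "nat \<Rightarrow> nat" and c01 c23 M :: nat
    assume X: "X \<ge> 3" and char: "\<forall>i\<in>{0,1,2,3}. dirichlet_character 8 (\<chi> i)"
      and np: "\<exists>i\<in>{0,1}. \<exists>j\<in>{2,3}. \<chi> i \<noteq> principal_character 8 \<and> \<chi> j \<noteq> principal_character 8"
      and r: "\<forall>i\<in>{0,1,2,3}. odd (r i) \<and> 1 \<le> r i \<and> real (r i) \<le> ln X powr C1"
      and c01: "1 \<le> c01" "real c01 \<le> ln X powr C2"
      and c23: "1 \<le> c23" "real c23 \<le> ln X powr C2"
      and M: "1 \<le> M" "real M \<le> ln X powr C2"
    have d: "dirichlet_character 8 (\<chi> 0)" "dirichlet_character 8 (\<chi> 1)"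
      "dirichlet_character 8 (\<chi> 2)" "dirichlet_character 8 (\<chi> 3)" using char by auto
    obtain \<psi>0 where \<psi>0: "real_char8 \<psi>0" "\<And>n. \<chi> 0 (int n) = of_real (\<psi>0 n)"
      "\<chi> 0 \<noteq> principal_character 8 \<Longrightarrow> \<exists>a. \<psi>0 a = -1"
      using dirichlet_character_8_real[OF d(1)] by blast
    obtain \<psi>1 where \<psi>1: "real_char8 \<psi>1" "\<And>n. \<chi> 1 (int n) = of_real (\<psi>1 n)"
      "\<chi> 1 \<noteq> principal_character 8 \<Longrightarrow> \<exists>a. \<psi>1 a = -1"
      using dirichlet_character_8_real[OF d(2)] by blast
    obtain \<psi>2 where \<psi>2: "real_char8 \<psi>2" "\<And>n. \<chi> 2 (int n) = of_real (\<psi>2 n)"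
      "\<chi> 2 \<noteq> principal_character 8 \<Longrightarrow> \<exists>a. \<psi>2 a = -1"
      using dirichlet_character_8_real[OF d(3)] by blast
    obtain \<psi>3 where \<psi>3: "real_char8 \<psi>3" "\<And>n. \<chi> 3 (int n) = of_real (\<psi>3 n)"
      "\<chi> 3 \<noteq> principal_character 8 \<Longrightarrow> \<exists>a. \<psi>3 a = -1"
      using dirichlet_character_8_real[OF d(4)] by blast
    have np01: "\<exists>a. \<psi>0 a = -1 \<or> \<psi>1 a = -1" and np23: "\<exists>a. \<psi>2 a = -1 \<or> \<psi>3 a = -1"
      using np \<psi>0(3) \<psi>1(3) \<psi>2(3) \<psi>3(3) by auto
    define Y where "Y c = X / (real c * real M)" for c
    \<comment> \<open>Each half saves sqrt (ln X), so the product saves ln X.\<close>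
    have half: "\<bar>\<Sum>w\<in>pair_range (Y c) q s. pair_term \<psi> \<phi> w\<bar>
        \<le> K * (real (divisor_count q * divisor_count s) * Y c * sqrt (L / ln X))"
      if "real_char8 \<psi>" "real_char8 \<phi>" "\<exists>a. \<psi> a = -1 \<or> \<phi> a = -1" "q \<ge> 1" "s \<ge> 1"
        and c: "1 \<le> c" "real c \<le> ln X powr C2" for \<psi> \<phi> q s c
    proof (cases "Y c \<ge> 1")
      case True
      have lnX: "ln X > 0" using X by simp
      have lnY: "ln (Y c) \<ge> 0" using True by simp
      have "ln X \<le> L * (1 + ln (Y c))"
        unfolding Y_def using X c M True by (intro L(2)) (auto simp: Y_def)
      then have "1 / (1 + ln (Y c)) \<le> L / ln X"
        using lnX lnY by (simp add: field_simps)
      then have "sqrt (1 / (1 + ln (Y c))) \<le> sqrt (L / ln X)" by (rule real_sqrt_le_mono)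
      then have s: "1 / sqrt (1 + ln (Y c)) \<le> sqrt (L / ln X)" by (simp add: real_sqrt_divide)
      have "\<bar>\<Sum>w\<in>pair_range (Y c) q s. pair_term \<psi> \<phi> w\<bar>
          \<le> K * (real (divisor_count q * divisor_count s) * Y c * (1 / sqrt (1 + ln (Y c))))"
        using K(2)[of \<psi> \<phi> q s "Y c"] that True by simp
      also have "\<dots> \<le> K * (real (divisor_count q * divisor_count s) * Y c * sqrt (L / ln X))"
        using K(1) True s by (intro mult_left_mono) auto
      finally show ?thesis .
    next
      case False
      \<comment> \<open>The bound for sums over pairs needs an argument of at least 1; below that there are no pairs.\<close>
      have "pair_range (Y c) q s = {}"
      proof (rule ccontr)
        assume "pair_range (Y c) q s \<noteq> {}"
        then obtain a b where "a \<ge> 1" "b \<ge> 1" "real (a * b) \<le> Y c"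
          by (auto simp: pair_range_def)
        moreover from this have "1 \<le> a * b" by simp
        then have "1 \<le> real (a * b)" by (metis of_nat_1 of_nat_le_iff)
        ultimately show False using False by linarith
      qed
      moreover have "Y c \<ge> 0" "sqrt (L / ln X) \<ge> 0" using X L(1) by (simp_all add: Y_def)
      ultimately show ?thesis using K(1) by simp
    qed
    let ?S01 = "\<Sum>w\<in>pair_range (Y c01) (r 0) (r 1). pair_term \<psi>0 \<psi>1 w"
    let ?S23 = "\<Sum>w\<in>pair_range (Y c23) (r 2) (r 3). pair_term \<psi>2 \<psi>3 w"
    have term_eq: "\<chi> 0 (int n0) * \<chi> 2 (int n2) * \<chi> 1 (int n1) * \<chi> 3 (int n3) /
          of_nat (divisor_count n0 * divisor_count n1 * divisor_count n2 * divisor_count n3)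
        = complex_of_real (pair_term \<psi>0 \<psi>1 (n0, n1)) * complex_of_real (pair_term \<psi>2 \<psi>3 (n2, n3))"
      for n0 n1 n2 n3
      by (simp add: pair_term_def \<psi>0(2) \<psi>1(2)[unfolded One_nat_def] \<psi>2(2) \<psi>3(2) mult_ac)
    have "(\<Sum>(n0, n1, n2, n3)\<in>summation_range X r c01 c23 M.
             \<chi> 0 (int n0) * \<chi> 2 (int n2) * \<chi> 1 (int n1) * \<chi> 3 (int n3) /
             of_nat (divisor_count n0 * divisor_count n1 * divisor_count n2 * divisor_count n3))
        = complex_of_real ?S01 * complex_of_real ?S23"
      using sum_summation_range_factors[OF c01(1) c23(1) M(1),
          where f = "\<lambda>w. complex_of_real (pair_term \<psi>0 \<psi>1 w)"
            and g = "\<lambda>w. complex_of_real (pair_term \<psi>2 \<psi>3 w)"]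
      by (simp only: term_eq Y_def of_real_sum)
    then have "cmod (\<Sum>(n0, n1, n2, n3)\<in>summation_range X r c01 c23 M.
             \<chi> 0 (int n0) * \<chi> 2 (int n2) * \<chi> 1 (int n1) * \<chi> 3 (int n3) /
             of_nat (divisor_count n0 * divisor_count n1 * divisor_count n2 * divisor_count n3))
        = \<bar>?S01\<bar> * \<bar>?S23\<bar>"
      by (simp only: norm_mult norm_of_real)
    also have "\<dots> \<le> (K * (real (divisor_count (r 0) * divisor_count (r 1)) * Y c01 * sqrt (L / ln X))) *
        (K * (real (divisor_count (r 2) * divisor_count (r 3)) * Y c23 * sqrt (L / ln X)))"
    proof (rule mult_mono)
      show "\<bar>?S01\<bar> \<le> K * (real (divisor_count (r 0) * divisor_count (r 1)) * Y c01 * sqrt (L / ln X))"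
        using r c01 by (intro half \<psi>0 \<psi>1 np01) auto
      show "\<bar>?S23\<bar> \<le> K * (real (divisor_count (r 2) * divisor_count (r 3)) * Y c23 * sqrt (L / ln X))"
        using r c23 by (intro half \<psi>2 \<psi>3 np23) auto
    qed (use K L X in \<open>auto simp: Y_def\<close>)
    also have "\<dots> = K\<^sup>2 * (sqrt (L / ln X) * sqrt (L / ln X)) *
        (real (divisor_count (r 0) * divisor_count (r 1) * divisor_count (r 2) * divisor_count (r 3)) * (Y c01 * Y c23))"
      by (simp only: power2_eq_square of_nat_mult mult_ac)
    also have "sqrt (L / ln X) * sqrt (L / ln X) = L / ln X"
      using L X by (intro real_sqrt_mult_self[THEN trans]) auto
    finally show "cmod (\<Sum>(n0, n1, n2, n3)\<in>summation_range X r c01 c23 M.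
             \<chi> 0 (int n0) * \<chi> 2 (int n2) * \<chi> 1 (int n1) * \<chi> 3 (int n3) /
             of_nat (divisor_count n0 * divisor_count n1 * divisor_count n2 * divisor_count n3))
       \<le> K\<^sup>2 * L * (real (divisor_count (r 0) * divisor_count (r 1) * divisor_count (r 2) * divisor_count (r 3)) * X^2
              / (real c01 * real c23 * (real M)^2 * ln X))"
      by (simp add: Y_def power2_eq_square mult_ac)
  qed
qed

end
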